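(* Let $n\ge 2$, let $p\in(0,1]$, and let $K$ be an origin-symmetric $p$-convex body in $\mathbb{R}^n$. Then the intersection body $IK$ of $K$ is $q$-convex for $$q=\left[\left(\frac1p-1\right)(n-1)+1\right]^{-1}.$$
   Context: A body is a compact set with nonempty interior. For a body $K\subset\mathbb{R}^n$ that is star-shaped with respect to the origin, its Minkowski functional is $\|x\|_K=\min\{\lambda\ge 0: x\in\lambda K\}$ and its radial function is $\rho_K(u)=\max\{\lambda\ge 0:\lambda u\in K\}$ for $u\in S^{n-1}$, so $\rho_K(u)=\|u\|_K^{-1}$. $K$ is a star body if it is star-shaped at the origin and $\rho_K$ is positive and continuous on $S^{n-1}$. For $p\in(0,1]$, a body $K$ is $p$-convex if $\|x+y\|_K^p\le\|x\|_K^p+\|y\|_K^p$ for all $x,y\in\mathbb{R}^n$; equivalently, $t^{1/p}x+(1-t)^{1/p}y\in K$ whenever $x,y\in K$ and $t\in(0,1)$. (An origin-symmetric $p$-convex body is a star body.) The intersection body $IK$ of a star body $K$ in $\mathbb{R}^n$ is the star body with radial function $\rho_{IK}(u)=|K\cap u^\perp|$ for $u\in S^{n-1}$, where $u^\perp=\{x\in\mathbb{R}^n:x\cdot u=0\}$ and $|\cdot|$ is $(n-1)$-dimensional Lebesgue measure. *)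

theory Defs
  imports "HOL-Analysis.Analysis"
begin

section \<open>Bodies, radial functions and Minkowski functionals\<close>

definition body :: "'a::euclidean_space set \<Rightarrow> bool" where
  "body K \<longleftrightarrow> compact K \<and> interior K \<noteq> {}"

definition origin_symmetric :: "'a::real_vector set \<Rightarrow> bool" where
  "origin_symmetric K \<longleftrightarrow> (\<forall>x\<in>K. - x \<in> K)"

definition star_shaped :: "'a::real_vector set \<Rightarrow> bool" where
  "star_shaped K \<longleftrightarrow> (\<forall>x\<in>K. closed_segment 0 x \<subseteq> K)"

definition absorbing :: "'a::real_vector set \<Rightarrow> bool" where
  "absorbing K \<longleftrightarrow> (\<forall>x. \<exists>l\<ge>0. x \<in> (*\<^sub>R) l ` K)"

text \<open>The infimum and the supremum below are attained for the sets of interest, see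
  \<open>Minkowski_attained\<close> and \<open>radial_attained\<close>.\<close>

definition Minkowski :: "'a::real_vector set \<Rightarrow> 'a \<Rightarrow> real" where
  "Minkowski K x = Inf {l. 0 \<le> l \<and> x \<in> (*\<^sub>R) l ` K}"

definition radial :: "'a::real_vector set \<Rightarrow> 'a \<Rightarrow> real" where
  "radial K u = Sup {l. 0 \<le> l \<and> l *\<^sub>R u \<in> K}"

definition star_body :: "'a::euclidean_space set \<Rightarrow> bool" where
  "star_body K \<longleftrightarrow> body K \<and> star_shaped K \<and>
     (\<forall>u\<in>sphere 0 1. 0 < radial K u) \<and> continuous_on (sphere 0 1) (radial K)"

text \<open>Star-shapedness and absorption only make the Minkowski functional a well-defined
  real function on the whole space.  For an origin-symmetric body they impose nothing extra, see
  \<open>p_convex_iff\<close>.\<close>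

definition p_convex :: "real \<Rightarrow> 'a::euclidean_space set \<Rightarrow> bool" where
  "p_convex p K \<longleftrightarrow> body K \<and> star_shaped K \<and> absorbing K \<and>
     (\<forall>x y. Minkowski K (x + y) powr p \<le> Minkowski K x powr p + Minkowski K y powr p)"

section \<open>Volume of hyperplane sections and the intersection body\<close>

definition orthonormal_basis :: "'a::euclidean_space set \<Rightarrow> 'a set \<Rightarrow> bool" where
  "orthonormal_basis S B \<longleftrightarrow> pairwise orthogonal B \<and> (\<forall>b\<in>B. norm b = 1) \<and> span B = S"

text \<open>Lebesgue measure of dimension \<open>dim S\<close> on a linear subspace \<open>S\<close>, built from
  an orthonormal basis of \<open>S\<close> just as \<open>lborel\<close> is built from \<open>Basis\<close>.
  By rotation invariance it does not depend on the chosen basis.\<close>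

definition lborel_on :: "'a::euclidean_space set \<Rightarrow> 'a measure" where
  "lborel_on S =
     (let B = (SOME B. orthonormal_basis S B)
      in distr (\<Pi>\<^sub>M b\<in>B. lborel) borel (\<lambda>f. \<Sum>b\<in>B. f b *\<^sub>R b))"

definition hyperplane :: "'a::euclidean_space \<Rightarrow> 'a set" where
  "hyperplane u = {x. x \<bullet> u = 0}"

definition section_volume :: "'a::euclidean_space set \<Rightarrow> 'a \<Rightarrow> real" where
  "section_volume K u = measure (lborel_on (hyperplane u)) (K \<inter> hyperplane u)"

text \<open>The set with radial function \<open>section_volume K\<close>; see
  \<open>radial_intersection_body\<close> and \<open>intersection_body_unique\<close>.\<close>

definition intersection_body :: "'a::euclidean_space set \<Rightarrow> 'a set" where
  "intersection_body K = {r *\<^sub>R u | r u. norm u = 1 \<and> 0 \<le> r \<and> r \<le> section_volume K u}"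

section \<open>Basic facts\<close>

lemma orthonormal_basis_ex:
  assumes "subspace S"
  shows "\<exists>B. orthonormal_basis S B"
  using orthonormal_basis_subspace[OF assms] unfolding orthonormal_basis_def by metis

lemma Minkowski_attained:
  fixes K :: "'a::euclidean_space set"
  assumes "compact K" "absorbing K"
  shows "0 \<le> Minkowski K x" "x \<in> (*\<^sub>R) (Minkowski K x) ` K"
    "\<And>l. 0 \<le> l \<Longrightarrow> x \<in> (*\<^sub>R) l ` K \<Longrightarrow> Minkowski K x \<le> l"
proof -
  let ?A = "{l. 0 \<le> l \<and> x \<in> (*\<^sub>R) l ` K}"
  obtain m where m: "0 \<le> m" "x \<in> (*\<^sub>R) m ` K"
    using assms(2) unfolding absorbing_def by blast
  let ?P = "({0..m} \<times> K) \<inter> {z. fst z *\<^sub>R snd z = x}"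
  have "closed {z::real \<times> 'a. fst z *\<^sub>R snd z = x}"
    by (intro closed_Collect_eq continuous_intros)
  then have "compact ?P"
    by (intro compact_Int_closed compact_Times assms) auto
  then have "compact (fst ` ?P)"
    by (intro compact_continuous_image continuous_intros)
  moreover have "fst ` ?P \<noteq> {}"
    using m by force
  ultimately have "\<exists>k\<in>fst ` ?P. \<forall>l\<in>fst ` ?P. k \<le> l"
    by (rule compact_attains_inf)
  then obtain k where k: "k \<in> fst ` ?P" "\<And>l. l \<in> fst ` ?P \<Longrightarrow> k \<le> l"
    by (elim bexE) (rule that, assumption, erule bspec)
  have kA: "k \<in> ?A"
    using k(1) by force
  have kle: "k \<le> l" if "l \<in> ?A" for l
  proof (cases "l \<le> m")
    case True
    with that have "l \<in> fst ` ?P" by force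
    then show ?thesis by (rule k(2))
  next
    case False
    then show ?thesis using k(1) by auto
  qed
  have "Minkowski K x = k"
    unfolding Minkowski_def using kA kle by (intro cInf_eq_minimum) auto
  with kA kle show "0 \<le> Minkowski K x" "x \<in> (*\<^sub>R) (Minkowski K x) ` K"
    "\<And>l. 0 \<le> l \<Longrightarrow> x \<in> (*\<^sub>R) l ` K \<Longrightarrow> Minkowski K x \<le> l"
    by auto
qed

lemma radial_attained:
  fixes K :: "'a::euclidean_space set"
  assumes "compact K" "0 \<in> K" "norm u = 1"
  shows "0 \<le> radial K u" "radial K u *\<^sub>R u \<in> K"
    "\<And>l. 0 \<le> l \<Longrightarrow> l *\<^sub>R u \<in> K \<Longrightarrow> l \<le> radial K u"
proof -
  let ?A = "{l. 0 \<le> l \<and> l *\<^sub>R u \<in> K}"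
  obtain M where M: "\<And>x. x \<in> K \<Longrightarrow> norm x \<le> M"
    using compact_imp_bounded[OF assms(1)] unfolding bounded_iff by blast
  have bdd: "bdd_above ?A"
    using M assms(3) by (intro bdd_aboveI[of _ M]) force
  have "closed ((\<lambda>l. l *\<^sub>R u) -` K)"
    by (intro closed_vimage compact_imp_closed assms continuous_intros)
  moreover have "?A = {0..} \<inter> (\<lambda>l. l *\<^sub>R u) -` K"
    by auto
  ultimately have "closed ?A"
    by (simp add: closed_Int)
  moreover have "0 \<in> ?A"
    using assms(2) by simp
  ultimately have "Sup ?A \<in> ?A"
    using bdd by (intro closed_contains_Sup) auto
  then show "0 \<le> radial K u" "radial K u *\<^sub>R u \<in> K"
    unfolding radial_def by auto
  show "\<And>l. 0 \<le> l \<Longrightarrow> l *\<^sub>R u \<in> K \<Longrightarrow> l \<le> radial K u"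
    unfolding radial_def using bdd by (intro cSup_upper) auto
qed

lemma section_volume_nonneg: "0 \<le> section_volume K u"
  by (simp add: section_volume_def)

lemma radial_intersection_body:
  fixes u :: "'a::euclidean_space"
  assumes "norm u = 1"
  shows "radial (intersection_body K) u = section_volume K u"
  unfolding radial_def
proof (rule cSup_eq_maximum)
  show "section_volume K u \<in> {l. 0 \<le> l \<and> l *\<^sub>R u \<in> intersection_body K}"
    using assms section_volume_nonneg unfolding intersection_body_def by blast
  fix l assume l: "l \<in> {l. 0 \<le> l \<and> l *\<^sub>R u \<in> intersection_body K}"
  then obtain r v where rv: "l *\<^sub>R u = r *\<^sub>R v" "norm v = 1" "0 \<le> r" "r \<le> section_volume K v"
    unfolding intersection_body_def by blast
  have "norm (l *\<^sub>R u) = norm (r *\<^sub>R v)"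
    using rv(1) by simp
  then have "l = r" using l rv(2,3) assms by (simp only: norm_scaleR) auto
  show "l \<le> section_volume K u"
  proof (cases "l = 0")
    case True
    then show ?thesis by (simp add: section_volume_nonneg)
  next
    case False
    with rv(1) \<open>l = r\<close> have "u = v" by simp
    with rv \<open>l = r\<close> show ?thesis by simp
  qed
qed

lemma star_body_zero:
  assumes "star_body K"
  shows "0 \<in> K"
  using assms interior_subset[of K] unfolding star_body_def body_def star_shaped_def by force

lemma intersection_body_unique:
  assumes "star_body L" and rad: "\<And>u. norm u = 1 \<Longrightarrow> radial L u = section_volume K u"
  shows "L = intersection_body K"
proof -
  have L: "compact L" "0 \<in> L" "star_shaped L"
    using assms(1) star_body_zero by (auto simp: star_body_def body_def)
  have "x \<in> L \<longleftrightarrow> x \<in> intersection_body K" for x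
  proof
    assume x: "x \<in> L"
    obtain u :: 'a where u: "norm u = 1" "x = norm x *\<^sub>R u"
    proof (cases "x = 0")
      case True
      then show ?thesis using that[of "SOME b. b \<in> Basis"] by (simp add: SOME_Basis)
    next
      case False
      then show ?thesis using that[of "x /\<^sub>R norm x"] by simp
    qed
    then have "norm x \<le> section_volume K u"
      using radial_attained(3)[OF L(1,2) u(1), of "norm x"] x rad by simp
    then show "x \<in> intersection_body K"
      unfolding intersection_body_def using u norm_ge_zero by blast
  next
    assume "x \<in> intersection_body K"
    then obtain r u where ru: "x = r *\<^sub>R u" "norm u = 1" "0 \<le> r" "r \<le> section_volume K u"
      unfolding intersection_body_def by blast
    have R: "radial L u *\<^sub>R u \<in> L" "r \<le> radial L u"
      using radial_attained(2)[OF L(1,2) ru(2)] ru rad by auto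
    have "x \<in> closed_segment 0 (radial L u *\<^sub>R u)"
    proof (cases "r = 0")
      case True
      then show ?thesis using ru by simp
    next
      case False
      then have "0 \<le> r / radial L u" "r / radial L u \<le> 1" "x = (r / radial L u) *\<^sub>R (radial L u *\<^sub>R u)"
        using ru R by (auto simp: divide_simps)
      then show ?thesis by (auto simp: in_segment)
    qed
    then show "x \<in> L"
      using R L unfolding star_shaped_def by blast
  qed
  then show ?thesis by blast
qed

lemma p_convex_iff:
  fixes K :: "'a::euclidean_space set"
  assumes K: "body K" "origin_symmetric K" and p: "0 < p"
  shows "p_convex p K \<longleftrightarrow>
    (\<forall>x\<in>K. \<forall>y\<in>K. \<forall>t. 0 < t \<and> t < 1 \<longrightarrow> t powr (1/p) *\<^sub>R x + (1 - t) powr (1/p) *\<^sub>R y \<in> K)"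
    (is "_ \<longleftrightarrow> ?R")
proof
  assume P: "p_convex p K"
  then have c: "compact K" and a: "absorbing K" and s: "star_shaped K"
    unfolding p_convex_def body_def by auto
  note M = Minkowski_attained[OF c a]
  show ?R
  proof (intro ballI allI impI)
    fix x y t assume x: "x \<in> K" and y: "y \<in> K" and t: "0 < t \<and> t < (1::real)"
    have *: "Minkowski K (t powr (1/p) *\<^sub>R x) powr p \<le> t" if "x \<in> K" "0 < t" for x t
    proof -
      have "Minkowski K (t powr (1/p) *\<^sub>R x) \<le> t powr (1/p)"
        using that by (intro M(3)) auto
      then have "Minkowski K (t powr (1/p) *\<^sub>R x) powr p \<le> (t powr (1/p)) powr p"
        using M(1) p by (intro powr_mono2) auto
      then show ?thesis using that p by (simp add: powr_powr)
    qed
    let ?z = "t powr (1/p) *\<^sub>R x + (1 - t) powr (1/p) *\<^sub>R y"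
    have "Minkowski K ?z powr p \<le> t + (1 - t)"
      using P *[OF x, of t] *[OF y, of "1 - t"] t unfolding p_convex_def
      by (smt (verit, best))
    then have le1: "Minkowski K ?z \<le> 1"
      using p M(1)[of ?z] powr_less_mono2[of p 1 "Minkowski K ?z"] by fastforce
    obtain k where k: "k \<in> K" "?z = Minkowski K ?z *\<^sub>R k"
      using M(2)[of ?z] by blast
    then have "?z \<in> closed_segment 0 k"
      using le1 M(1)[of ?z] by (auto simp: in_segment)
    then show "?z \<in> K"
      using k(1) s unfolding star_shaped_def by blast
  qed
next
  assume R: ?R
  obtain a e where ae: "0 < e" "ball a e \<subseteq> K"
    using K(1) unfolding body_def by (auto simp: mem_interior)
  define h :: real where "h = (1/2) powr (1/p)"
  have h: "0 < h" by (simp add: h_def)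
  have ball: "h *\<^sub>R z \<in> K" if "norm z < e" for z
  proof -
    have "a + z \<in> K" "- a \<in> K"
      using ae that K(2) by (auto simp: origin_symmetric_def dist_norm subset_iff)
    from R[rule_format, OF this, of "1/2"] have "h *\<^sub>R (a + z) + h *\<^sub>R (- a) \<in> K"
      by (simp add: h_def)
    then show ?thesis by (simp add: algebra_simps)
  qed
  have zero: "0 \<in> K" using ball[of 0] ae by simp
  have star: "star_shaped K"
    unfolding star_shaped_def
  proof (intro ballI subsetI)
    fix x y assume x: "x \<in> K" and "y \<in> closed_segment 0 x"
    then obtain s where s: "0 \<le> s" "s \<le> 1" "y = s *\<^sub>R x"
      by (auto simp: in_segment)
    consider "s = 0" | "s = 1" | "0 < s" "s < 1" using s by linarith
    then show "y \<in> K"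
    proof cases
      case 3
      have "0 < s powr p" "s powr p < 1"
        using 3 p powr_less_mono2[of p s 1] by auto
      from R[rule_format, OF x zero conjI[OF this]] show ?thesis
        using 3 p s by (simp add: powr_powr)
    qed (use s x zero in auto)
  qed
  have abso: "absorbing K"
    unfolding absorbing_def
  proof
    fix x
    show "\<exists>l\<ge>0. x \<in> (*\<^sub>R) l ` K"
    proof (cases "x = 0")
      case True
      then show ?thesis using zero by (intro exI[of _ 1]) force
    next
      case False
      let ?c = "e / (2 * norm x)"
      have "h *\<^sub>R (?c *\<^sub>R x) \<in> K"
        using False ae by (intro ball) auto
      moreover have "x = (1 / (h * ?c)) *\<^sub>R (h *\<^sub>R (?c *\<^sub>R x))"
        using False ae h by simp
      ultimately show ?thesis
        using False ae h by (intro exI[of _ "1 / (h * ?c)"] conjI image_eqI) auto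
    qed
  qed
  have c: "compact K" using K(1) by (simp add: body_def)
  note M = Minkowski_attained[OF c abso]
  have M0: "Minkowski K 0 = 0"
    using M(1)[of 0] M(3)[of 0 0] zero by force
  have "Minkowski K (x + y) powr p \<le> Minkowski K x powr p + Minkowski K y powr p" for x y
  proof -
    let ?a = "Minkowski K x" and ?b = "Minkowski K y"
    obtain k l where k: "k \<in> K" "x = ?a *\<^sub>R k" and l: "l \<in> K" "y = ?b *\<^sub>R l"
      using M(2)[of x] M(2)[of y] by blast
    show ?thesis
    proof (cases "?a = 0 \<or> ?b = 0")
      case True
      then have "x = 0 \<or> y = 0" using k(2) l(2) by (metis scaleR_zero_left)
      then show ?thesis by auto
    next
      case False
      then have a: "0 < ?a" and b: "0 < ?b"
        using M(1)[of x] M(1)[of y] by auto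
      define S where "S = ?a powr p + ?b powr p"
      have ap: "0 < ?a powr p" "0 < ?b powr p" using a b by auto
      from this have S: "0 < S" unfolding S_def by (rule add_pos_pos)
      define t where "t = ?a powr p / S"
      have t: "0 < t" "t < 1" "1 - t = ?b powr p / S"
        using ap S by (auto simp: t_def S_def field_simps)
      have e1: "S powr (1/p) * t powr (1/p) = ?a"
        using a S p by (simp add: t_def powr_divide powr_powr)
      have e2: "S powr (1/p) * (1 - t) powr (1/p) = ?b"
        using b S p by (simp add: t(3) powr_divide powr_powr)
      let ?w = "t powr (1/p) *\<^sub>R k + (1 - t) powr (1/p) *\<^sub>R l"
      have "?w \<in> K" using R k l t by blast
      moreover have "x + y = S powr (1/p) *\<^sub>R ?w"
        using k(2) l(2) e1 e2 by (simp add: scaleR_right_distrib)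
      ultimately have "Minkowski K (x + y) \<le> S powr (1/p)"
        by (intro M(3)) auto
      then have "Minkowski K (x + y) powr p \<le> (S powr (1/p)) powr p"
        using M(1) p by (intro powr_mono2) auto
      then show ?thesis using S p by (simp add: powr_powr S_def)
    qed
  qed
  then show "p_convex p K"
    unfolding p_convex_def using K star abso by blast
qed

end

theory Submission
  imports Defs "HOL-Probability.Probability"
begin

text \<open>
  Busemann's theorem is derived from a one-dimensional inequality that reproduces itself.  If
  \<open>H (s + t) \<le> F s + G t\<close> for positive functions on the line and \<open>e > 1\<close>, then
  \<open>\<integral>H\<^bsup>-e\<^esup>\<close> raised to the power \<open>-1/(e-1)\<close> is at most the sum of the same expressions for
  \<open>F\<close> and \<open>G\<close>.  Hence, if \<open>\<phi>\<close> is subadditive and homogeneous of degree \<open>p\<close>, so is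
  \<open>\<psi> v = (\<integral>\<phi> (v + s b)\<^bsup>-e\<^esup> ds)\<^bsup>-1/(e-1)\<^esup>\<close> on the orthogonal complement of \<open>b\<close>, with degree
  \<open>(e p - 1)/(e - 1)\<close>.  Since \<open>\<psi>\<^bsup>-(e-1)\<^esup>\<close> is again the integral of \<open>\<phi>\<^bsup>-e\<^esup>\<close>, the step can be
  iterated.  Starting from the \<open>p\<close>-th power of the Minkowski functional with \<open>e = (n-1)/p\<close>,
  after \<open>n - 2\<close> steps the degree is \<open>q\<close>.  By polar integration, what is obtained on the
  remaining plane is, up to a rotation and a constant, the \<open>q\<close>-th power of the Minkowski functional
  of the intersection body.
\<close>

section \<open>The one-dimensional inequality\<close>

text \<open>The triangle inequality for the intersection body concerns two vectors, hence one plane.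
  Every hyperplane orthogonal to a unit vector u of that plane contains the whole (n-2)-dimensional
  complement of the plane, together with the line spanned by u turned through a right angle. So the
  same n - 2 directions can be integrated out for all u at once, and this is where the rotation
  comes from. The exponent has the same origin: on a section of dimension n - 1, integrating along
  rays leaves the power -(n-1) of the Minkowski functional, which is the power -e of its
  \<open>p\<close>-th power for e = (n-1)/p. One integration lowers e and e p by one each. After n -
  2 of them e p has become 1 and e has become (n-1)/p - (n-2) = 1/q, so the degree is q. Convergence
  needs e p \<ge> 2 before each integration, and the initial value n - 1 is exactly enough. The
  \<open>p\<close>-th power is used because it turns \<open>p\<close>-convexity into plain
  subadditivity, the form in which the transport argument accepts it.\<close>

lemma weighted_powr_sum_ge:
  fixes a b \<alpha> \<beta> e :: real
  assumes e: "1 \<le> e" and pos: "0 < a" "0 < b" "0 < \<alpha>" "0 < \<beta>"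
  shows "(a + b) powr e * (\<alpha> + \<beta>) powr (1 - e) \<le> \<alpha> powr (1 - e) * a powr e + \<beta> powr (1 - e) * b powr e"
proof -
  let ?s = "\<alpha> + \<beta>"
  have s: "0 < ?s" using pos by simp
  have sum1: "1 - \<beta> / ?s = \<alpha> / ?s" using s by (simp add: field_simps)
  \<comment> \<open>Jensen's inequality for the power \<open>e\<close> at the points
    \<open>a / \<alpha>\<close> and \<open>b / \<beta>\<close>, with weights proportional to
    \<open>\<alpha>\<close> and \<open>\<beta>\<close>; multiplied by
    \<open>\<alpha> + \<beta>\<close> it is Radon's inequality.\<close>
  have "((1 - \<beta> / ?s) *\<^sub>R (a / \<alpha>) + (\<beta> / ?s) *\<^sub>R (b / \<beta>)) powr e
      \<le> (1 - \<beta> / ?s) * (a / \<alpha>) powr e + (\<beta> / ?s) * (b / \<beta>) powr e"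
    using convex_onD[OF powr_convex[OF e], of "\<beta> / ?s" "a / \<alpha>" "b / \<beta>"] pos by simp
  also have "(1 - \<beta> / ?s) *\<^sub>R (a / \<alpha>) + (\<beta> / ?s) *\<^sub>R (b / \<beta>) = (a + b) / ?s"
    unfolding sum1 using pos by (simp add: add_divide_distrib)
  also have "((a + b) / ?s) powr e = (a + b) powr e * ?s powr (1 - e) / ?s"
    using pos s by (simp add: powr_divide powr_diff)
  also have "(1 - \<beta> / ?s) * (a / \<alpha>) powr e + (\<beta> / ?s) * (b / \<beta>) powr e
     = (\<alpha> powr (1 - e) * a powr e + \<beta> powr (1 - e) * b powr e) / ?s"
    unfolding sum1 using pos s by (simp add: powr_divide powr_diff add_divide_distrib ac_simps)
  finally show ?thesis
    using s by (simp add: divide_le_cancel)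
qed

section \<open>Distribution functions and monotone transport on the line\<close>

text \<open>The cdf of the measure with density \<open>f\<close> supplies the limits at both ends,
  an antiderivative of \<open>f\<close> supplies the derivative, and the two differ by a constant.
  Positivity of \<open>f\<close> makes the bounds strict, so the values stay in an open interval on
  which an inverse can be differentiated.\<close>

lemma distribution_function:
  fixes f :: "real \<Rightarrow> real"
  assumes cont: "continuous_on UNIV f" and pos: "\<And>x. 0 < f x" and int: "integrable lborel f"
  obtains \<Phi> where "\<And>x. (\<Phi> has_real_derivative f x) (at x)"
    "(\<Phi> \<longlongrightarrow> 0) at_bot" "(\<Phi> \<longlongrightarrow> integral\<^sup>L lborel f) at_top"
    "\<And>x. 0 < \<Phi> x" "\<And>x. \<Phi> x < integral\<^sup>L lborel f" "strict_mono \<Phi>"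
proof -
  have [measurable]: "f \<in> borel_measurable borel"
    using cont by (rule borel_measurable_continuous_onI)
  define M where "M = density lborel (\<lambda>x. ennreal (f x))"
  have nonneg: "0 \<le> f x" for x using pos[of x] by simp
  have total: "emeasure M (space M) = ennreal (integral\<^sup>L lborel f)"
    unfolding M_def using int nonneg
    by (simp add: emeasure_density nn_integral_eq_integral)
  have fbm: "finite_borel_measure M"
  proof (intro finite_borel_measure.intro finite_borel_measure_axioms.intro finite_measureI)
    show "emeasure M (space M) \<noteq> \<infinity>" unfolding total by simp
    show "sets M = sets borel" by (simp add: M_def)
  qed
  have mtotal: "measure M (space M) = integral\<^sup>L lborel f"
    using total nonneg by (simp add: measure_def integral_nonneg_AE)
  obtain A where A: "\<And>x. (A has_real_derivative f x) (at x)"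
    using einterval_antiderivative[of "-\<infinity>" "\<infinity>" f] cont
    by (auto simp: continuous_on_eq_continuous_at has_real_derivative_iff_has_vector_derivative)
  have Amono: "strict_mono A"
    unfolding strict_mono_def using DERIV_pos_imp_increasing A pos by (metis)
  have diff: "cdf M y - cdf M x = A y - A x" if "x < y" for x y
  proof -
    have "emeasure M {x<..y} = (\<integral>\<^sup>+t. ennreal (f t) * indicator {x<..y} t \<partial>lborel)"
      unfolding M_def by (simp add: emeasure_density)
    also have "\<dots> = (\<integral>\<^sup>+t. ennreal (f t) * indicator {x..y} t \<partial>lborel)"
    proof (rule nn_integral_cong_AE)
      have "AE t in lborel. t \<noteq> x" by (rule AE_lborel_singleton)
      then show "AE t in lborel. ennreal (f t) * indicator {x<..y} t = ennreal (f t) * indicator {x..y} t"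
        by eventually_elim (simp add: indicator_def)
    qed
    also have "\<dots> = ennreal (A y - A x)"
      using that A nonneg by (intro nn_integral_FTC_Icc) auto
    finally have "measure M {x<..y} = A y - A x"
      using strict_monoD[OF Amono that] by (simp add: measure_def)
    then show ?thesis using finite_borel_measure.cdf_diff_eq[OF fbm that] by simp
  qed
  define k where "k = cdf M 0 - A 0"
  have eq: "cdf M x = A x + k" for x
    unfolding k_def using diff[of x 0] diff[of 0 x] by (cases x "0::real" rule: linorder_cases) auto
  have d: "(cdf M has_real_derivative f x) (at x)" for x
    by (subst ext[OF eq]) (auto intro!: derivative_eq_intros A)
  have mono: "strict_mono (cdf M)"
    using Amono eq by (simp add: strict_mono_def)
  have "0 < cdf M x" for x
    using finite_borel_measure.cdf_nonneg[OF fbm, of "x - 1"] strict_monoD[OF mono, of "x - 1" x] by simp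
  moreover have "cdf M x < integral\<^sup>L lborel f" for x
    using finite_borel_measure.cdf_bounded[OF fbm, of "x + 1"] strict_monoD[OF mono, of x "x + 1"] mtotal by simp
  ultimately show ?thesis
    using that[of "cdf M"] d mono mtotal
      finite_borel_measure.cdf_lim_at_bot[OF fbm] finite_borel_measure.cdf_lim_at_top[OF fbm] by simp
qed

text \<open>\<open>T\<close> comes from conservation of mass:
  \<open>\<Psi> (T x) = ?c * \<Phi> x\<close>, where \<open>?c\<close> is the quotient of the total
  masses; differentiating gives the formula. The factor \<open>?c\<close> puts
  \<open>?c * \<Phi> x\<close> strictly inside the range of \<open>\<Psi>\<close>, so this holds on
  the whole line.\<close>

lemma monotone_transport:
  fixes f g :: "real \<Rightarrow> real"
  assumes cf: "continuous_on UNIV f" and pf: "\<And>x. 0 < f x" and If: "integrable lborel f"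
    and cg: "continuous_on UNIV g" and pg: "\<And>x. 0 < g x" and Ig: "integrable lborel g"
  obtains T where "continuous_on UNIV T"
    "\<And>x. (T has_real_derivative integral\<^sup>L lborel g / integral\<^sup>L lborel f * (f x / g (T x))) (at x)"
proof -
  let ?c = "integral\<^sup>L lborel g / integral\<^sup>L lborel f"
  obtain \<Phi> where \<Phi>: "\<And>x. (\<Phi> has_real_derivative f x) (at x)"
    "\<And>x. 0 < \<Phi> x" "\<And>x. \<Phi> x < integral\<^sup>L lborel f"
    using distribution_function[OF cf pf If] by metis
  obtain \<Psi> where \<Psi>: "\<And>x. (\<Psi> has_real_derivative g x) (at x)"
    "(\<Psi> \<longlongrightarrow> 0) at_bot" "(\<Psi> \<longlongrightarrow> integral\<^sup>L lborel g) at_top"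
    "\<And>x. 0 < \<Psi> x" "\<And>x. \<Psi> x < integral\<^sup>L lborel g" "strict_mono \<Psi>"
    using distribution_function[OF cg pg Ig] by metis
  have f0: "0 < integral\<^sup>L lborel f" using \<Phi>(2,3) less_trans by metis
  have g0: "0 < integral\<^sup>L lborel g" using \<Psi>(4,5) less_trans by metis
  have contP: "isCont \<Psi> x" for x using \<Psi>(1) DERIV_isCont by blast
  define R where "R = inv \<Psi>"
  have RP: "R (\<Psi> x) = x" for x
    unfolding R_def using strict_mono_imp_inj_on[OF \<Psi>(6)] by simp
  \<comment> \<open>A right inverse only between 0 and the total mass: there the limits of
    \<open>\<Psi>\<close> at both ends and the intermediate value theorem provide a
    preimage.\<close>
  have PR: "\<Psi> (R y) = y" if y: "0 < y" "y < integral\<^sup>L lborel g" for y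
  proof -
    have "eventually (\<lambda>x. \<Psi> x < y) at_bot" using \<Psi>(2) y(1) by (rule order_tendstoD)
    then obtain a where a: "\<Psi> a < y" using eventually_happens by fastforce
    have "eventually (\<lambda>x. y < \<Psi> x) at_top" using \<Psi>(3) y(2) by (rule order_tendstoD)
    then obtain b where b: "y < \<Psi> b" using eventually_happens by fastforce
    have "\<Psi> a < \<Psi> b" using a b by (rule less_trans)
    then have "a \<le> b" using strict_mono_less[OF \<Psi>(6)] by (simp add: less_imp_le)
    with a b obtain x where "\<Psi> x = y"
      using IVT[of \<Psi> a y b] contP by auto
    then show ?thesis using RP by auto
  qed
  have contR: "isCont R y" if y: "0 < y" "y < integral\<^sup>L lborel g" for y
    using isCont_inverse_function[of 1 "R y" R \<Psi>] RP contP PR[OF y] by simp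
  have dR: "(R has_real_derivative inverse (g (R y))) (at y)" if y: "0 < y" "y < integral\<^sup>L lborel g" for y
  proof (rule DERIV_inverse_function[where a=0 and b="integral\<^sup>L lborel g"])
    show "(\<Psi> has_real_derivative g (R y)) (at (R y))" by (rule \<Psi>)
    show "g (R y) \<noteq> 0" using pg[of "R y"] by simp
  qed (use y PR contR in auto)
  define T where "T x = R (?c * \<Phi> x)" for x
  have rng: "0 < ?c * \<Phi> x" "?c * \<Phi> x < integral\<^sup>L lborel g" for x
    using f0 g0 \<Phi>(2,3)[of x] by (auto simp: field_simps)
  have dT: "(T has_real_derivative ?c * (f x / g (T x))) (at x)" for x
  proof -
    have "((\<lambda>x. R (?c * \<Phi> x)) has_real_derivative inverse (g (R (?c * \<Phi> x))) * (?c * f x)) (at x)"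
      by (rule DERIV_chain2[OF dR[OF rng] DERIV_cmult[OF \<Phi>(1)]])
    then show ?thesis by (simp add: T_def[abs_def] field_simps)
  qed
  then have "continuous_on UNIV T"
    by (intro continuous_at_imp_continuous_on ballI) (rule DERIV_isCont)
  with dT show ?thesis by (rule that[rotated])
qed

text \<open>\<open>T\<close> transports \<open>F powr -e\<close> to \<open>G powr -e\<close>, both normalised to mass one, and
  \<open>z = x + T x\<close> is substituted in the integral of \<open>H powr -e\<close>.\<close>

lemma infimal_convolution_integral:
  fixes F G H :: "real \<Rightarrow> real"
  assumes e: "1 < e"
    and cont: "continuous_on UNIV F" "continuous_on UNIV G" "continuous_on UNIV H"
    and pos: "\<And>x. 0 < F x" "\<And>x. 0 < G x" "\<And>x. 0 < H x"
    and le: "\<And>x y. H (x + y) \<le> F x + G y"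
    and int: "integrable lborel (\<lambda>x. F x powr - e)" "integrable lborel (\<lambda>x. G x powr - e)"
      "integrable lborel (\<lambda>x. H x powr - e)"
  shows "(LINT x|lborel. H x powr - e) powr (- 1 / (e - 1)) \<le>
    (LINT x|lborel. F x powr - e) powr (- 1 / (e - 1)) + (LINT x|lborel. G x powr - e) powr (- 1 / (e - 1))"
proof -
  have nz: "F x \<noteq> 0" "G x \<noteq> 0" "H x \<noteq> 0" for x
    using pos[of x] by auto
  have cp: "continuous_on UNIV (\<lambda>x. F x powr - e)" "continuous_on UNIV (\<lambda>x. G x powr - e)"
    "continuous_on UNIV (\<lambda>x. H x powr - e)"
    using nz by (auto intro!: continuous_intros cont)
  have pp: "0 < F x powr - e" "0 < G x powr - e" for x
    using nz[of x] by auto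
  define I where "I = (LINT x|lborel. F x powr - e)"
  define J where "J = (LINT x|lborel. G x powr - e)"
  define L where "L = (LINT x|lborel. H x powr - e)"
  have I0: "0 < I" unfolding I_def
    using distribution_function[OF cp(1) pp(1) int(1)] less_trans by metis
  have J0: "0 < J" unfolding J_def
    using distribution_function[OF cp(2) pp(2) int(2)] less_trans by metis
  \<comment> \<open>The two terms of the right-hand side. Their powers with exponent
    \<open>1 - e\<close> are \<open>I\<close> and \<open>J\<close>, so the claim is equivalent to
    \<open>m \<le> L\<close>.\<close>
  define \<alpha> where "\<alpha> = I powr (- 1 / (e - 1))"
  define \<beta> where "\<beta> = J powr (- 1 / (e - 1))"
  have ab: "0 < \<alpha>" "0 < \<beta>" using I0 J0 by (auto simp: \<alpha>_def \<beta>_def)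
  have ee: "(- 1 / (e - 1)) * (1 - e) = 1" using e by (simp add: field_simps)
  then have \<alpha>I: "\<alpha> powr (1 - e) = I" "\<beta> powr (1 - e) = J"
    using I0 J0 by (simp_all add: \<alpha>_def \<beta>_def powr_powr)
  define m where "m = (\<alpha> + \<beta>) powr (1 - e)"
  have m0: "0 < m" using ab by (simp add: m_def)
  obtain T where T: "continuous_on UNIV T"
    "\<And>x. (T has_real_derivative J / I * (F x powr - e / G (T x) powr - e)) (at x)"
    unfolding I_def J_def using monotone_transport[OF cp(1) pp(1) int(1) cp(2) pp(2) int(2)] by metis
  define Z' where "Z' x = 1 + J / I * (F x powr - e / G (T x) powr - e)" for x
  have Z'0: "0 \<le> Z' x" for x
    using I0 J0 by (auto simp: Z'_def)
  have Z'c: "continuous_on UNIV Z'"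
    unfolding Z'_def[abs_def] using nz
    by (intro continuous_intros cp(1) continuous_on_compose2[OF cont(2) T(1)]) auto
  \<comment> \<open>The weighted inequality is applied at \<open>F x\<close> and
    \<open>G (T x)\<close>. Its right-hand side \<open>I * ?a powr e + J * ?b powr e\<close> equals
    \<open>I * ?a powr e * Z' x\<close>, so the derivative of \<open>x + T x\<close> appears
    exactly. The bound on \<open>H\<close> enters under a negative power.\<close>
  have key: "m / I * F x powr - e \<le> H (x + T x) powr - e * Z' x" for x
  proof -
    let ?a = "F x" and ?b = "G (T x)"
    have abp: "0 < ?a" "0 < ?b" using pos by auto
    have "(?a + ?b) powr e * m \<le> I * ?a powr e + J * ?b powr e"
      using weighted_powr_sum_ge[of e ?a ?b \<alpha> \<beta>] e abp ab unfolding \<alpha>I m_def by simp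
    then have "m \<le> (?a + ?b) powr - e * (I * ?a powr e + J * ?b powr e)"
      using abp by (simp add: powr_minus field_simps)
    then have "m / I * ?a powr - e \<le> (?a + ?b) powr - e * (I * ?a powr e + J * ?b powr e) / I * ?a powr - e"
      using I0 by (intro mult_right_mono divide_right_mono) auto
    also have "\<dots> = (?a + ?b) powr - e * Z' x"
      using abp I0 by (simp add: Z'_def powr_minus field_simps)
    also have "\<dots> \<le> H (x + T x) powr - e * Z' x"
      using le[of x "T x"] pos(3)[of "x + T x"] e Z'0
      by (intro mult_right_mono powr_mono2') auto
    finally show ?thesis .
  qed
  have [measurable]: "(\<lambda>x. H x powr - e) \<in> borel_measurable borel"
    "(\<lambda>x. F x powr - e) \<in> borel_measurable borel"
    using cp by (auto intro: borel_measurable_continuous_onI)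
  \<comment> \<open>The substitution is made on a bounded interval, whose image is then enlarged to
    the whole line; dominated convergence afterwards removes the cut-off on the left.\<close>
  have bound: "m / I * (LINT x|lborel. indicator {- real k..real k} x * F x powr - e) \<le> L" for k
  proof -
    let ?k = "real k" and ?Z = "\<lambda>x. x + T x"
    have "ennreal (m / I * (LINT x|lborel. indicator {- ?k..?k} x * F x powr - e))
        = ennreal (LINT x|lborel. m / I * (indicator {- ?k..?k} x * F x powr - e))"
      by simp
    also have "\<dots> = (\<integral>\<^sup>+x. ennreal (m / I * (indicator {- ?k..?k} x * F x powr - e)) \<partial>lborel)"
      using m0 I0 int(1) integrable_mult_indicator[OF _ int(1), of "{- ?k..?k}"]
      by (intro nn_integral_eq_integral[symmetric]) auto
    also have "\<dots> \<le> (\<integral>\<^sup>+x. ennreal (H (?Z x) powr - e * Z' x * indicator {- ?k..?k} x) \<partial>lborel)"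
      using key Z'0 by (intro nn_integral_mono) (auto split: split_indicator intro!: ennreal_leI)
    also have "\<dots> = (\<integral>\<^sup>+x. ennreal (H x powr - e * indicator {?Z (- ?k)..?Z ?k} x) \<partial>lborel)"
    proof (rule nn_integral_substitution[symmetric])
      show "set_borel_measurable borel {?Z (- ?k)..?Z ?k} (\<lambda>x. H x powr - e)"
        unfolding set_borel_measurable_def by measurable
      show "(?Z has_real_derivative Z' x) (at x)" for x
        unfolding Z'_def by (auto intro!: derivative_eq_intros T(2))
      show "continuous_on {- ?k..?k} Z'" using Z'c continuous_on_subset by blast
    qed (use Z'0 in auto)
    also have "\<dots> \<le> (\<integral>\<^sup>+x. ennreal (H x powr - e) \<partial>lborel)"
      by (intro nn_integral_mono) (auto split: split_indicator)
    also have "\<dots> = ennreal L"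
      unfolding L_def by (intro nn_integral_eq_integral int) auto
    finally show ?thesis
      by (subst (asm) ennreal_le_iff) (auto simp: L_def intro!: integral_nonneg_AE)
  qed
  have "(\<lambda>k. LINT x|lborel. indicator {- real k..real k} x * F x powr - e) \<longlonglongrightarrow> I"
    unfolding I_def
  proof (rule integral_dominated_convergence[where w="\<lambda>x. F x powr - e"])
    show "AE x in lborel. (\<lambda>k. indicator {- real k..real k} x * F x powr - e) \<longlonglongrightarrow> F x powr - e"
    proof (intro AE_I2 tendsto_eventually)
      fix x :: real
      obtain k0 where "\<bar>x\<bar> \<le> real k0" using real_arch_simple by blast
      then show "\<forall>\<^sub>F k in sequentially. indicator {- real k..real k} x * F x powr - e = F x powr - e"
        by (intro eventually_sequentiallyI[of k0]) (auto simp: indicator_def)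
    qed
  qed (use int in \<open>auto split: split_indicator\<close>)
  then have "(\<lambda>k. m / I * (LINT x|lborel. indicator {- real k..real k} x * F x powr - e)) \<longlonglongrightarrow> m / I * I"
    by (intro tendsto_intros)
  then have "m / I * I \<le> L"
    by (rule LIMSEQ_le_const2) (use bound in blast)
  then have "m \<le> L" using I0 by simp
  then have "L powr (- 1 / (e - 1)) \<le> m powr (- 1 / (e - 1))"
    using m0 e by (intro powr_mono2') auto
  also have "m powr (- 1 / (e - 1)) = \<alpha> + \<beta>"
    using ab ee unfolding m_def powr_powr by (simp add: mult.commute)
  finally show ?thesis
    by (simp add: L_def \<alpha>_def \<beta>_def I_def J_def)
qed

section \<open>Subadditive homogeneous functions\<close>

text \<open>The \<open>p\<close>-th power of a symmetric quasi-norm: degree \<open>p\<close>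
  together with plain subadditivity encodes \<open>p\<close>-convexity without outer powers. The
  domain is a subspace because each integration passes to vectors orthogonal to the direction
  integrated out.\<close>

definition gauge_on :: "'a::euclidean_space set \<Rightarrow> real \<Rightarrow> ('a \<Rightarrow> real) \<Rightarrow> bool" where
  "gauge_on W p \<phi> \<longleftrightarrow> subspace W \<and> 0 < p \<and> p \<le> 1 \<and> (\<forall>x\<in>W. x \<noteq> 0 \<longrightarrow> 0 < \<phi> x) \<and>
     (\<forall>x\<in>W. \<forall>c. \<phi> (c *\<^sub>R x) = \<bar>c\<bar> powr p * \<phi> x) \<and> (\<forall>x\<in>W. \<forall>y\<in>W. \<phi> (x + y) \<le> \<phi> x + \<phi> y)"

lemma gauge_on_zero:
  assumes "gauge_on W p \<phi>" shows "\<phi> 0 = 0"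
proof -
  have "0 \<in> W" using assms by (simp add: gauge_on_def subspace_0)
  then have "\<phi> (0 *\<^sub>R 0) = \<bar>0\<bar> powr p * \<phi> 0" using assms unfolding gauge_on_def by blast
  then show ?thesis by simp
qed

lemma gauge_on_nonneg:
  assumes "gauge_on W p \<phi>" "x \<in> W" shows "0 \<le> \<phi> x"
  using assms gauge_on_zero[OF assms(1)] unfolding gauge_on_def by (cases "x = 0") (auto simp: less_imp_le)

lemma gauge_on_cong:
  assumes "gauge_on W p \<phi>" "subspace W'" "W' \<subseteq> W" "\<And>x. x \<in> W' \<Longrightarrow> \<psi> x = \<phi> x"
  shows "gauge_on W' p \<psi>"
  using assms unfolding gauge_on_def by (simp add: subspace_add subspace_scale subset_iff)

text \<open>Expansion in an orthonormal basis turns subadditivity and homogeneity into a bound.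
  Continuity is not assumed of a gauge; it is deduced from this bound.\<close>

lemma gauge_on_upper_bound:
  assumes g: "gauge_on W p \<phi>"
  obtains C where "0 \<le> C" "\<And>x. x \<in> W \<Longrightarrow> \<phi> x \<le> C * norm x powr p"
proof -
  have W: "subspace W" and p: "0 < p" and hom: "\<And>x c. x \<in> W \<Longrightarrow> \<phi> (c *\<^sub>R x) = \<bar>c\<bar> powr p * \<phi> x"
    and sub: "\<And>x y. x \<in> W \<Longrightarrow> y \<in> W \<Longrightarrow> \<phi> (x + y) \<le> \<phi> x + \<phi> y"
    using g unfolding gauge_on_def by auto
  obtain B where B: "B \<subseteq> W" "pairwise orthogonal B" "\<And>b. b \<in> B \<Longrightarrow> norm b = 1"
    "independent B" "span B = W"
    using orthonormal_basis_subspace[OF W] by metis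
  have fB: "finite B" using B(4) by (rule independent_imp_finite)
  have sum: "\<phi> (\<Sum>b\<in>A. f b *\<^sub>R b) \<le> (\<Sum>b\<in>A. \<phi> (f b *\<^sub>R b))" if "A \<subseteq> B" for A f
    using finite_subset[OF that fB] that
  proof (induction A rule: finite_induct)
    case empty
    then show ?case using gauge_on_zero[OF g] by simp
  next
    case (insert b A)
    have "\<phi> (f b *\<^sub>R b + (\<Sum>b\<in>A. f b *\<^sub>R b)) \<le> \<phi> (f b *\<^sub>R b) + \<phi> (\<Sum>b\<in>A. f b *\<^sub>R b)"
      using insert.prems B(1) W by (intro sub subspace_sum subspace_scale) auto
    then show ?case using insert by auto
  qed
  show ?thesis
  proof (rule that[of "\<Sum>b\<in>B. \<phi> b"])
    show "0 \<le> (\<Sum>b\<in>B. \<phi> b)" using gauge_on_nonneg[OF g] B(1) by (intro sum_nonneg) auto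
    fix x assume x: "x \<in> W"
    have "x = (\<Sum>b\<in>B. (x \<bullet> b) *\<^sub>R b)"
      using orthonormal_basis_expand[OF B(2,3) _ fB, of x] x B(5) by simp
    then have "\<phi> x \<le> (\<Sum>b\<in>B. \<phi> ((x \<bullet> b) *\<^sub>R b))" using sum[OF subset_refl, of "\<lambda>b. x \<bullet> b"] by metis
    also have "\<dots> \<le> (\<Sum>b\<in>B. norm x powr p * \<phi> b)"
    proof (rule sum_mono)
      fix b assume b: "b \<in> B"
      have "\<bar>x \<bullet> b\<bar> \<le> norm x" using Cauchy_Schwarz_ineq2[of x b] B(3)[OF b] by simp
      then have "\<bar>x \<bullet> b\<bar> powr p \<le> norm x powr p" using p by (intro powr_mono2) auto
      moreover have "b \<in> W" using b B(1) by auto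
      ultimately show "\<phi> ((x \<bullet> b) *\<^sub>R b) \<le> norm x powr p * \<phi> b"
        using hom[of b "x \<bullet> b"] gauge_on_nonneg[OF g, of b] by (simp add: mult_right_mono)
    qed
    finally show "\<phi> x \<le> (\<Sum>b\<in>B. \<phi> b) * norm x powr p"
      by (simp add: sum_distrib_right mult.commute)
  qed
qed

text \<open>By subadditivity a difference of values is at most the value at the difference, so the
  upper bound gives Hoelder continuity with exponent \<open>p\<close>.\<close>

lemma gauge_on_continuous:
  assumes g: "gauge_on W p \<phi>"
  shows "continuous_on W \<phi>"
proof -
  have W: "subspace W" and p: "0 < p" and hom: "\<And>x c. x \<in> W \<Longrightarrow> \<phi> (c *\<^sub>R x) = \<bar>c\<bar> powr p * \<phi> x"
    and sub: "\<And>x y. x \<in> W \<Longrightarrow> y \<in> W \<Longrightarrow> \<phi> (x + y) \<le> \<phi> x + \<phi> y"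
    using g unfolding gauge_on_def by auto
  obtain C where C: "0 \<le> C" "\<And>x. x \<in> W \<Longrightarrow> \<phi> x \<le> C * norm x powr p"
    using gauge_on_upper_bound[OF g] by blast
  have half: "\<phi> x - \<phi> y \<le> C * norm (x - y) powr p" if "x \<in> W" "y \<in> W" for x y
  proof -
    have "\<phi> x \<le> \<phi> (x - y) + \<phi> y" using sub[of "x - y" y] that subspace_diff[OF W] by simp
    with C(2)[of "x - y"] that subspace_diff[OF W] show ?thesis by fastforce
  qed
  have dist: "dist (\<phi> y) (\<phi> x) \<le> C * norm (y - x) powr p" if "x \<in> W" "y \<in> W" for x y
    using half[OF that] half[OF that(2,1)] by (simp add: dist_real_def norm_minus_commute)
  show ?thesis
    unfolding continuous_on_def
  proof
    fix x assume x: "x \<in> W"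
    have "((\<lambda>y. C * norm (y - x) powr p) \<longlongrightarrow> C * 0 powr p) (at x within W)"
      using p by (intro tendsto_intros tendsto_powr' tendsto_eq_intros) auto
    then have "((\<lambda>y. C * norm (y - x) powr p) \<longlongrightarrow> 0) (at x within W)" by simp
    then show "(\<phi> \<longlongrightarrow> \<phi> x) (at x within W)"
      unfolding tendsto_dist_iff[of \<phi>]
      by (rule tendsto_sandwich[rotated 3, of _ _ _ "\<lambda>_. 0"])
         (use dist[OF x] in \<open>auto simp: eventually_at_filter\<close>)
  qed
qed

text \<open>Compactness of the unit sphere of \<open>W\<close> and homogeneity. The bound supplies
  the decay of the line integrals and, at the end, the boundedness of the unit ball.\<close>

lemma gauge_on_lower_bound:
  assumes g: "gauge_on W p \<phi>"
  obtains c where "0 < c" "\<And>x. x \<in> W \<Longrightarrow> c * norm x powr p \<le> \<phi> x"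
proof -
  have W: "subspace W" and p: "0 < p" and hom: "\<And>x c. x \<in> W \<Longrightarrow> \<phi> (c *\<^sub>R x) = \<bar>c\<bar> powr p * \<phi> x"
    and pos: "\<And>x. x \<in> W \<Longrightarrow> x \<noteq> 0 \<Longrightarrow> 0 < \<phi> x"
    using g unfolding gauge_on_def by auto
  let ?S = "sphere 0 1 \<inter> W"
  have "compact ?S" using closed_subspace[OF W] by (intro compact_Int_closed) auto
  moreover have "continuous_on ?S \<phi>"
    using gauge_on_continuous[OF g] by (rule continuous_on_subset) simp
  ultimately have "\<exists>c>0. \<forall>x\<in>?S. c \<le> \<phi> x"
  proof (cases "?S = {}")
    case False
    then obtain z where z: "z \<in> ?S" "\<And>x. x \<in> ?S \<Longrightarrow> \<phi> z \<le> \<phi> x"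
      using continuous_attains_inf[OF \<open>compact ?S\<close> _ \<open>continuous_on ?S \<phi>\<close>] by metis
    then have "0 < \<phi> z" by (intro pos) auto
    with z(2) show ?thesis by metis
  qed (auto intro: exI[of _ 1])
  then obtain c where c: "0 < c" "\<And>x. x \<in> ?S \<Longrightarrow> c \<le> \<phi> x" by metis
  show ?thesis
  proof (rule that[OF c(1)])
    fix x assume x: "x \<in> W"
    show "c * norm x powr p \<le> \<phi> x"
    proof (cases "x = 0")
      case True
      then show ?thesis using gauge_on_zero[OF g] by simp
    next
      case False
      let ?u = "x /\<^sub>R norm x"
      have u: "?u \<in> W" using x W by (intro subspace_scale)
      then have "?u \<in> ?S" using False by simp
      then have "c \<le> \<phi> ?u" by (rule c)
      moreover have "x = norm x *\<^sub>R ?u" using False by simp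
      then have "\<phi> x = norm x powr p * \<phi> ?u" using hom[OF u, of "norm x"] by simp
      ultimately show ?thesis by (simp add: mult.commute[of c] mult_left_mono)
    qed
  qed
qed

lemma gauge_on_borel_measurable:
  assumes g: "gauge_on W p \<phi>" and h: "h \<in> borel_measurable M" "\<And>x. x \<in> space M \<Longrightarrow> h x \<in> W"
  shows "(\<lambda>x. \<phi> (h x)) \<in> borel_measurable M"
proof -
  have "\<phi> \<in> borel_measurable (restrict_space borel W)"
    using gauge_on_continuous[OF g] by (rule borel_measurable_continuous_on_restrict)
  moreover have "h \<in> measurable M (restrict_space borel W)"
    using h by (intro measurable_restrict_space2) auto
  ultimately show ?thesis by (rule measurable_compose[rotated])
qed

lemma integrable_inverse_one_plus_square: "integrable lborel (\<lambda>x::real. inverse (1 + x\<^sup>2))"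
  using integrable_inverse_1_plus_square by (simp add: set_integrable_def)

section \<open>Integration along a line and over an orthonormal family\<close>

text \<open>Orthogonality keeps the line away from the origin, where the integrand is singular. At
  infinity the lower bound gives decay of order \<open>e * p\<close>, and
  \<open>2 \<le> e * p\<close> permits comparison with
  \<open>inverse (1 + s\<^sup>2)\<close>.\<close>

lemma gauge_on_line:
  assumes g: "gauge_on W p \<phi>" and v: "v \<in> W" "v \<noteq> 0" and b: "b \<in> W" "norm b = 1" "v \<bullet> b = 0"
    and e: "2 \<le> e * p"
  shows "continuous_on UNIV (\<lambda>s. \<phi> (v + s *\<^sub>R b))" "\<And>s. 0 < \<phi> (v + s *\<^sub>R b)"
    "integrable lborel (\<lambda>s. \<phi> (v + s *\<^sub>R b) powr - e)"
    "0 < (LINT s|lborel. \<phi> (v + s *\<^sub>R b) powr - e)"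
proof -
  have W: "subspace W" and p: "0 < p" and pos: "\<And>x. x \<in> W \<Longrightarrow> x \<noteq> 0 \<Longrightarrow> 0 < \<phi> x"
    using g unfolding gauge_on_def by auto
  have e0: "0 < e" using e p by (smt (verit) mult_nonpos_nonneg)
  have mem: "v + s *\<^sub>R b \<in> W" for s using W v b by (intro subspace_add subspace_scale)
  have nsq: "(norm (v + s *\<^sub>R b))\<^sup>2 = (norm v)\<^sup>2 + s\<^sup>2" for s
    using b by (simp add: norm_eq_sqrt_inner real_sqrt_eq_1_iff power2_norm_eq_inner inner_add_left inner_add_right
        inner_commute power2_eq_square)
  have nz: "v + s *\<^sub>R b \<noteq> 0" for s
  proof
    assume "v + s *\<^sub>R b = 0"
    then have "(norm v)\<^sup>2 + s\<^sup>2 = 0" using nsq[of s] by simp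
    then show False using v by (simp add: add_nonneg_eq_0_iff)
  qed
  show cont: "continuous_on UNIV (\<lambda>s. \<phi> (v + s *\<^sub>R b))"
    by (rule continuous_on_compose2[OF gauge_on_continuous[OF g]]) (auto intro!: continuous_intros mem)
  show ps: "0 < \<phi> (v + s *\<^sub>R b)" for s using pos mem nz by blast
  then have nz': "\<phi> (v + s *\<^sub>R b) \<noteq> 0" for s by (metis less_irrefl)
  have cont2: "continuous_on UNIV (\<lambda>s. \<phi> (v + s *\<^sub>R b) powr - e)"
    using nz' by (auto intro!: continuous_intros cont)
  obtain c where c: "0 < c" "\<And>x. x \<in> W \<Longrightarrow> c * norm x powr p \<le> \<phi> x"
    using gauge_on_lower_bound[OF g] by blast
  \<comment> \<open>With this constant, \<open>(norm v)\<^sup>2 + s\<^sup>2\<close> is at least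
    \<open>k * (1 + s\<^sup>2)\<close>.\<close>
  define k where "k = min 1 ((norm v)\<^sup>2)"
  have k: "0 < k" using v by (simp add: k_def)
  define K where "K = c powr - e * k powr (- (e * p) / 2)"
  show int: "integrable lborel (\<lambda>s. \<phi> (v + s *\<^sub>R b) powr - e)"
  proof (rule Bochner_Integration.integrable_bound)
    show "integrable lborel (\<lambda>s. K * inverse (1 + s\<^sup>2))"
      by (intro integrable_mult_right integrable_inverse_one_plus_square)
    show "(\<lambda>s. \<phi> (v + s *\<^sub>R b) powr - e) \<in> borel_measurable lborel"
      using cont2 by (simp add: borel_measurable_continuous_onI)
    show "AE s in lborel. norm (\<phi> (v + s *\<^sub>R b) powr - e) \<le> norm (K * inverse (1 + s\<^sup>2))"
    proof (rule AE_I2)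
      fix s :: real
      let ?n = "norm (v + s *\<^sub>R b)" and ?q = "1 + s\<^sup>2"
      have n0: "0 < ?n" using nz by simp
      have q1: "1 \<le> ?q" by simp
      have "k \<le> (norm v)\<^sup>2" "k \<le> 1" by (auto simp: k_def)
      then have "k \<le> (norm v)\<^sup>2" "k * s\<^sup>2 \<le> 1 * s\<^sup>2"
        by (simp_all only: mult_right_mono zero_le_power2)
      then have kq: "k * ?q \<le> ?n\<^sup>2" unfolding nsq by (simp add: algebra_simps)
      have kq0: "0 < k * ?q" using k q1 by (intro mult_pos_pos) linarith+
      have npow: "(?n powr p) powr - e = (?n\<^sup>2) powr (- (e * p) / 2)"
        using n0 by (simp add: powr_powr mult.commute flip: powr_numeral)
      have "\<phi> (v + s *\<^sub>R b) powr - e \<le> (c * ?n powr p) powr - e"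
        using c mem n0 e0 by (intro powr_mono2') auto
      also have "\<dots> = c powr - e * (?n\<^sup>2) powr (- (e * p) / 2)"
        using c by (simp add: powr_mult npow)
      also have "\<dots> \<le> c powr - e * (k * ?q) powr (- (e * p) / 2)"
        using kq kq0 e by (intro mult_left_mono powr_mono2') simp_all
      also have "\<dots> = K * ?q powr (- (e * p) / 2)"
        using k q1 by (simp add: K_def powr_mult)
      also have "\<dots> \<le> K * ?q powr (- 1)"
        using q1 e by (intro mult_left_mono powr_mono) (auto simp: K_def)
      also have "\<dots> = K * inverse ?q"
        using q1 by (simp add: powr_minus powr_one)
      finally show "norm (\<phi> (v + s *\<^sub>R b) powr - e) \<le> norm (K * inverse ?q)"
        using q1 by (simp add: K_def)
    qed
  qed
  show "0 < (LINT s|lborel. \<phi> (v + s *\<^sub>R b) powr - e)"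
    using distribution_function[OF cont2 _ int] nz' less_trans by (metis powr_gt_zero)
qed

text \<open>Subadditivity is the one-dimensional inequality for the restrictions of
  \<open>\<phi>\<close> to the lines in direction \<open>b\<close> through \<open>v\<close>,
  \<open>w\<close> and \<open>v + w\<close>. The degree comes from substituting \<open>c * s\<close>
  for \<open>s\<close>, which produces the factor \<open>\<bar>c\<bar> powr (1 - e * p)\<close>
  under the outer exponent. The line through the origin meets the singularity, so the value at 0 is
  prescribed.\<close>

theorem gauge_on_integrate_line:
  assumes g: "gauge_on W p \<phi>" and b: "b \<in> W" "norm b = 1" and e: "2 \<le> e * p"
    and W': "subspace W'" "W' \<subseteq> W" "\<And>v. v \<in> W' \<Longrightarrow> v \<bullet> b = 0"
  shows "gauge_on W' ((e * p - 1) / (e - 1))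
    (\<lambda>v. if v = 0 then 0 else (LINT s|lborel. \<phi> (v + s *\<^sub>R b) powr - e) powr (- 1 / (e - 1)))"
    (is "gauge_on W' ?p ?\<psi>")
proof -
  have W: "subspace W" and p: "0 < p" "p \<le> 1" and hom: "\<And>x c. x \<in> W \<Longrightarrow> \<phi> (c *\<^sub>R x) = \<bar>c\<bar> powr p * \<phi> x"
    and sub: "\<And>x y. x \<in> W \<Longrightarrow> y \<in> W \<Longrightarrow> \<phi> (x + y) \<le> \<phi> x + \<phi> y"
    using g unfolding gauge_on_def by auto
  have "0 < e" using e p by (smt (verit) mult_nonpos_nonneg)
  then have "e * p \<le> e" using p by (simp add: mult_left_le)
  then have e1: "1 < e" using e by simp
  let ?I = "\<lambda>v. LINT s|lborel. \<phi> (v + s *\<^sub>R b) powr - e"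
  have mem: "v + s *\<^sub>R b \<in> W" if "v \<in> W'" for v s
    using W W'(2) that b by (intro subspace_add subspace_scale) auto
  note line = gauge_on_line[OF g _ _ b _ e]
  have I0: "0 < ?I v" if "v \<in> W'" "v \<noteq> 0" for v
    using line(4) W' that by blast
  have pos: "0 < ?\<psi> v" if "v \<in> W'" "v \<noteq> 0" for v
    using I0[OF that] that by simp
  have homo: "?\<psi> (c *\<^sub>R v) = \<bar>c\<bar> powr ?p * ?\<psi> v" if v: "v \<in> W'" for v c
  proof (cases "v = 0 \<or> c = 0")
    case False
    have "?I (c *\<^sub>R v) = \<bar>c\<bar> * (LINT s|lborel. \<phi> (c *\<^sub>R v + (c * s) *\<^sub>R b) powr - e)"
      using False lborel_integral_real_affine[of c "\<lambda>s. \<phi> (c *\<^sub>R v + s *\<^sub>R b) powr - e" 0] by simp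
    also have "(\<lambda>s. \<phi> (c *\<^sub>R v + (c * s) *\<^sub>R b) powr - e) = (\<lambda>s. \<bar>c\<bar> powr (- (e * p)) * \<phi> (v + s *\<^sub>R b) powr - e)"
    proof
      fix s
      have "\<phi> (c *\<^sub>R v + (c * s) *\<^sub>R b) = \<bar>c\<bar> powr p * \<phi> (v + s *\<^sub>R b)"
        using hom[OF mem[OF v], of c s] by (simp add: scaleR_add_right)
      then show "\<phi> (c *\<^sub>R v + (c * s) *\<^sub>R b) powr - e = \<bar>c\<bar> powr (- (e * p)) * \<phi> (v + s *\<^sub>R b) powr - e"
        using gauge_on_nonneg[OF g mem[OF v], of s] by (simp add: powr_mult powr_powr mult.commute)
    qed
    finally have "?I (c *\<^sub>R v) = \<bar>c\<bar> powr (1 - e * p) * ?I v"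
      using False by (simp add: powr_diff powr_minus divide_inverse)
    then have "?I (c *\<^sub>R v) powr (- 1 / (e - 1)) = \<bar>c\<bar> powr ((1 - e * p) * (- 1 / (e - 1))) * ?I v powr (- 1 / (e - 1))"
      using I0[OF v] False by (simp add: powr_mult powr_powr)
    moreover have "(1 - e * p) * (- 1 / (e - 1)) = ?p" using e1 by (simp add: field_simps)
    ultimately show ?thesis using False by simp
  qed auto
  have subadd: "?\<psi> (v + w) \<le> ?\<psi> v + ?\<psi> w" if vw: "v \<in> W'" "w \<in> W'" for v w
  proof (cases "v = 0 \<or> w = 0 \<or> v + w = 0")
    case True
    then show ?thesis by auto
  next
    case False
    have m: "v \<in> W" "w \<in> W" "v + w \<in> W" "v \<bullet> b = 0" "w \<bullet> b = 0" "(v + w) \<bullet> b = 0"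
      using vw W' subspace_add[OF W'(1) vw] by auto
    have "?I (v + w) powr (- 1 / (e - 1)) \<le> ?I v powr (- 1 / (e - 1)) + ?I w powr (- 1 / (e - 1))"
    proof (rule infimal_convolution_integral[OF e1])
      fix s t
      show "\<phi> (v + w + (s + t) *\<^sub>R b) \<le> \<phi> (v + s *\<^sub>R b) + \<phi> (w + t *\<^sub>R b)"
        using sub[OF mem[OF vw(1), of s] mem[OF vw(2), of t]] by (simp add: algebra_simps)
    qed (use line m False in auto)
    then show ?thesis using False by simp
  qed
  \<comment> \<open>Positive since \<open>2 \<le> e * p\<close>, and at most 1 since
    \<open>p \<le> 1\<close> gives \<open>e * p \<le> e\<close>.\<close>
  have "0 < ?p" "?p \<le> 1" using e e1 \<open>e * p \<le> e\<close> by auto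
  then show ?thesis
    unfolding gauge_on_def using W'(1) pos homo subadd by blast
qed

text \<open>Induction removes one coordinate at a time, and \<open>e\<close> and
  \<open>e * p\<close> drop by one together; hence the two differences in the degree. The bound on
  \<open>card S\<close> keeps \<open>e * p\<close> at least 2 before every removal. Nonnegative
  integrals let Fubini's theorem apply before finiteness is known.\<close>

theorem gauge_on_integrate:
  assumes "finite S" "pairwise orthogonal S" "\<And>b. b \<in> S \<Longrightarrow> norm b = 1"
    and "gauge_on W p \<phi>" "S \<subseteq> W" "real (card S) + 1 \<le> e * p"
    and "subspace W'" "W' \<subseteq> W" "\<And>v b. v \<in> W' \<Longrightarrow> b \<in> S \<Longrightarrow> v \<bullet> b = 0"
  shows "gauge_on W' ((e * p - card S) / (e - card S))
    (\<lambda>v. if v = 0 then 0 else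
       enn2real (\<integral>\<^sup>+c. ennreal (\<phi> (v + (\<Sum>b\<in>S. c b *\<^sub>R b)) powr - e) \<partial>(\<Pi>\<^sub>M b\<in>S. lborel)) powr (- 1 / (e - card S)))"
  using assms
proof (induction S arbitrary: W p \<phi> e rule: finite_induct)
  case empty
  interpret product_sigma_finite "\<lambda>_::'a. lborel :: real measure" by unfold_locales
  have p: "0 < p" and pos: "\<And>x. x \<in> W \<Longrightarrow> x \<noteq> 0 \<Longrightarrow> 0 < \<phi> x"
    using empty.prems(3) unfolding gauge_on_def by auto
  have e0: "0 < e" using empty.prems p by (smt (verit) mult_nonpos_nonneg of_nat_0_le_iff)
  have "gauge_on W' p (\<lambda>v. if v = 0 then 0 else
    enn2real (\<integral>\<^sup>+c. ennreal (\<phi> (v + (\<Sum>b\<in>{}. c b *\<^sub>R b)) powr - e) \<partial>(\<Pi>\<^sub>M b\<in>{}. lborel)) powr (- 1 / (e - card ({}::'a set))))"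
  proof (rule gauge_on_cong[OF empty.prems(3,6,7)])
    fix v assume v: "v \<in> W'"
    have "(\<integral>\<^sup>+c. ennreal (\<phi> (v + (\<Sum>b\<in>{}. c b *\<^sub>R b)) powr - e) \<partial>(\<Pi>\<^sub>M b\<in>({}::'a set). lborel)) = ennreal (\<phi> v powr - e)"
      by (subst nn_integral_empty) simp_all
    then show "(if v = 0 then 0 else
      enn2real (\<integral>\<^sup>+c. ennreal (\<phi> (v + (\<Sum>b\<in>{}. c b *\<^sub>R b)) powr - e) \<partial>(\<Pi>\<^sub>M b\<in>{}. lborel)) powr (- 1 / (e - card ({}::'a set))))
      = \<phi> v"
      using gauge_on_zero[OF empty.prems(3)] pos[of v] v empty.prems(7) e0
      by (auto simp: powr_powr)
  qed
  then show ?case using e0 by simp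
next
  case (insert b S)
  interpret product_sigma_finite "\<lambda>_::'a. lborel :: real measure" by unfold_locales
  have W: "subspace W" and p: "0 < p" "p \<le> 1"
    using insert.prems(3) unfolding gauge_on_def by auto
  have cS: "card (insert b S) = Suc (card S)" using insert.hyps by simp
  have e2: "2 \<le> e * p" using insert.prems(5) cS by simp
  have "0 < e" using e2 p by (smt (verit) mult_nonpos_nonneg)
  then have "e * p \<le> e" using p by (simp add: mult_left_le)
  then have e1: "1 < e" using e2 by simp
  have bS: "b \<in> W" "norm b = 1" "S \<subseteq> W" using insert.prems by auto
  have orth: "x \<bullet> b = 0" if "x \<in> S" for x
    using insert.prems(1) insert.hyps(2) that unfolding pairwise_def orthogonal_def by auto
  \<comment> \<open>The remaining directions \<open>S\<close> and the target \<open>W'\<close> both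
    lie in this complement of \<open>b\<close>, so the induction hypothesis applies to it.\<close>
  define V where "V = {v \<in> W. v \<bullet> b = 0}"
  have V: "subspace V" "V \<subseteq> W" "\<And>v. v \<in> V \<Longrightarrow> v \<bullet> b = 0"
    using W unfolding V_def subspace_def by (auto simp: inner_add_left)
  define \<psi> where "\<psi> v = (if v = 0 then 0 else (LINT s|lborel. \<phi> (v + s *\<^sub>R b) powr - e) powr (- 1 / (e - 1)))" for v
  define q where "q = (e * p - 1) / (e - 1)"
  have eq: "(e - 1) * q = e * p - 1" using e1 by (simp add: q_def)
  have g\<psi>: "gauge_on V q \<psi>"
    unfolding \<psi>_def q_def by (rule gauge_on_integrate_line[OF insert.prems(3) bS(1,2) e2 V])
  have IH: "gauge_on W' (((e - 1) * q - card S) / (e - 1 - card S))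
    (\<lambda>v. if v = 0 then 0 else
       enn2real (\<integral>\<^sup>+c. ennreal (\<psi> (v + (\<Sum>b\<in>S. c b *\<^sub>R b)) powr - (e - 1)) \<partial>(\<Pi>\<^sub>M b\<in>S. lborel)) powr (- 1 / (e - 1 - card S)))"
  proof (rule insert.IH[OF _ _ g\<psi>])
    show "pairwise orthogonal S" using insert.prems(1) by (simp add: pairwise_insert)
    show "real (card S) + 1 \<le> (e - 1) * q" using insert.prems(5) cS by (simp add: eq)
    show "S \<subseteq> V" using bS orth by (auto simp: V_def)
    show "W' \<subseteq> V" using insert.prems(7,8) by (auto simp: V_def)
  qed (use insert.prems in auto)
  \<comment> \<open>Fubini with the coordinate along \<open>b\<close> innermost. As \<open>v\<close>
    is nonzero and orthogonal to \<open>S\<close>, the points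
    \<open>v + (\<Sum>a\<in>S. c a *\<^sub>R a)\<close> never vanish, so \<open>\<psi>\<close> is
    always evaluated on its integral branch.\<close>
  have fub: "(\<integral>\<^sup>+c. ennreal (\<phi> (v + (\<Sum>b\<in>insert b S. c b *\<^sub>R b)) powr - e) \<partial>(\<Pi>\<^sub>M b\<in>insert b S. lborel))
    = (\<integral>\<^sup>+c. ennreal (\<psi> (v + (\<Sum>b\<in>S. c b *\<^sub>R b)) powr - (e - 1)) \<partial>(\<Pi>\<^sub>M b\<in>S. lborel))"
    if v: "v \<in> W'" "v \<noteq> 0" for v
  proof -
    have vW: "v \<in> W" using v insert.prems(7) by auto
    have memW: "v + (\<Sum>a\<in>A. c a *\<^sub>R a) \<in> W" if "A \<subseteq> insert b S" for A c
      using that insert.prems(4) vW W by (intro subspace_add subspace_sum subspace_scale) auto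
    have h: "(\<lambda>c. v + (\<Sum>a\<in>insert b S. c a *\<^sub>R a)) \<in> borel_measurable (\<Pi>\<^sub>M b\<in>insert b S. lborel)"
      by (intro borel_measurable_add borel_measurable_const borel_measurable_sum borel_measurable_scaleR)
         (auto intro!: measurable_component_singleton)
    have "(\<lambda>c. \<phi> (v + (\<Sum>a\<in>insert b S. c a *\<^sub>R a))) \<in> borel_measurable (\<Pi>\<^sub>M b\<in>insert b S. lborel)"
      by (rule gauge_on_borel_measurable[OF insert.prems(3) h memW]) simp
    then have meas: "(\<lambda>c. ennreal (\<phi> (v + (\<Sum>a\<in>insert b S. c a *\<^sub>R a)) powr - e)) \<in> borel_measurable (\<Pi>\<^sub>M b\<in>insert b S. lborel)"
      by measurable
    have upd: "(\<Sum>a\<in>insert b S. (c(b := y)) a *\<^sub>R a) = (\<Sum>a\<in>S. c a *\<^sub>R a) + y *\<^sub>R b" for c and y :: real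
    proof -
      have "(\<Sum>a\<in>S. (c(b := y)) a *\<^sub>R a) = (\<Sum>a\<in>S. c a *\<^sub>R a)"
        using insert.hyps by (intro sum.cong) auto
      then show ?thesis using insert.hyps by (simp add: add.commute)
    qed
    have inner: "(\<integral>\<^sup>+y. ennreal (\<phi> (v + ((\<Sum>a\<in>S. c a *\<^sub>R a) + y *\<^sub>R b)) powr - e) \<partial>lborel)
       = ennreal (\<psi> (v + (\<Sum>a\<in>S. c a *\<^sub>R a)) powr - (e - 1))" for c
    proof -
      let ?z = "v + (\<Sum>a\<in>S. c a *\<^sub>R a)"
      have "v \<bullet> (\<Sum>a\<in>S. c a *\<^sub>R a) = 0"
        using insert.prems(8)[OF v(1)] by (simp add: inner_sum_right)
      then have "v \<bullet> ?z = v \<bullet> v" by (simp add: inner_add_right)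
      then have z0: "?z \<noteq> 0" using v(2) by (metis inner_eq_zero_iff inner_zero_right)
      have zb: "?z \<bullet> b = 0"
        using insert.prems(8)[OF v(1), of b] orth by (simp add: inner_add_left inner_sum_left)
      have zW: "?z \<in> W" by (rule memW) auto
      note line = gauge_on_line[OF insert.prems(3) zW z0 bS(1,2) zb e2]
      have ee: "(- 1 / (e - 1)) * (- (e - 1)) = 1" using e1 by (simp add: field_simps)
      have "(\<integral>\<^sup>+y. ennreal (\<phi> (?z + y *\<^sub>R b) powr - e) \<partial>lborel) = ennreal (LINT y|lborel. \<phi> (?z + y *\<^sub>R b) powr - e)"
        by (intro nn_integral_eq_integral line) auto
      also have "(LINT y|lborel. \<phi> (?z + y *\<^sub>R b) powr - e) = \<psi> ?z powr - (e - 1)"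
        using z0 line(4) unfolding \<psi>_def by (simp only: powr_powr ee if_False) simp
      finally show ?thesis by (simp add: add.assoc)
    qed
    show ?thesis
      unfolding product_nn_integral_insert[OF insert.hyps meas] upd inner ..
  qed
  have ex: "e - 1 - real (card S) = e - card (insert b S)" "(e - 1) * q - real (card S) = e * p - card (insert b S)"
    using eq cS by auto
  show ?case
  proof (rule gauge_on_cong[OF IH[unfolded ex] insert.prems(6) subset_refl])
  qed (rule if_cong[OF refl refl], simp only: fub simp_thms)
qed

section \<open>Lebesgue measure in orthonormal coordinates\<close>

text \<open>Uniqueness of translation-invariant measures: with \<open>B\<close> the unit ball, integrate
  \<open>indicator A (T x) * indicator B (T x + y)\<close> over \<open>x\<close> and \<open>y\<close> in both orders.\<close>

lemma lborel_distr_orthogonal_transformation: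
  fixes T :: "'a::euclidean_space \<Rightarrow> 'a"
  assumes T: "orthogonal_transformation T"
  shows "distr lborel borel T = lborel"
proof (rule measure_eqI)
  show "sets (distr lborel borel T) = sets (lborel :: 'a measure)" by simp
  fix A assume "A \<in> sets (distr lborel borel T)"
  then have [measurable]: "A \<in> sets borel" by simp
  have lin: "linear T" using T by (rule orthogonal_transformation_linear)
  have Tm[measurable]: "T \<in> borel_measurable borel"
    using lin by (intro borel_measurable_continuous_onI linear_continuous_on) (simp add: linear_conv_bounded_linear)
  define B :: "'a set" where "B = ball 0 1"
  have [measurable]: "B \<in> sets borel" by (simp add: B_def)
  have B: "0 < emeasure lborel B" "emeasure lborel B < \<infinity>"
    unfolding B_def by (simp_all add: emeasure_ball emeasure_lborel_ball_finite)
  have TB: "T -` B = B"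
    using T by (auto simp: B_def orthogonal_transformation_norm)
  have shift: "(\<integral>\<^sup>+x. f (a + x) \<partial>lborel) = (\<integral>\<^sup>+x. f x \<partial>lborel)"
    if [measurable]: "f \<in> borel_measurable borel" for f :: "'a \<Rightarrow> ennreal" and a
    by (subst (2) lborel_distr_plus[symmetric, of a]) (simp add: nn_integral_distr)
  have flip: "(\<integral>\<^sup>+x. f (a - x) \<partial>lborel) = (\<integral>\<^sup>+x. f x \<partial>lborel)"
    if [measurable]: "f \<in> borel_measurable borel" for f :: "'a \<Rightarrow> ennreal" and a
    by (subst (2) lborel_affine[of "- 1" a]) (simp_all add: nn_integral_distr nn_integral_density)
  have "emeasure lborel (T -` A) * emeasure lborel B
      = (\<integral>\<^sup>+x. indicator A (T x) * (\<integral>\<^sup>+y. indicator B (T x + y) \<partial>lborel) \<partial>lborel)"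
  proof -
    have "(\<integral>\<^sup>+y. indicator B (T x + y) \<partial>lborel) = emeasure lborel B" for x
      using shift[of "indicator B" "T x"] by simp
    moreover have "T -` A \<in> sets borel" using measurable_sets[OF Tm, of A] by simp
    ultimately show ?thesis
      by (simp add: nn_integral_multc flip: indicator_vimage)
  qed
  also have "\<dots> = (\<integral>\<^sup>+x. (\<integral>\<^sup>+y. indicator A (T x) * indicator B (T x + y) \<partial>lborel) \<partial>lborel)"
    by (simp add: nn_integral_cmult)
  also have "\<dots> = (\<integral>\<^sup>+y. (\<integral>\<^sup>+x. indicator A (T x) * indicator B (T x + y) \<partial>lborel) \<partial>lborel)"
    by (rule lborel_pair.Fubini'[symmetric]) measurable
  also have "\<dots> = (\<integral>\<^sup>+y. (\<integral>\<^sup>+x. indicator A (T x - y) * indicator B (T x) \<partial>lborel) \<partial>lborel)"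
  proof (rule nn_integral_cong)
    fix y :: 'a
    \<comment> \<open>Translating \<open>x\<close> by \<open>- z\<close> replaces
      \<open>T x + y\<close> by \<open>T x\<close> and \<open>T x\<close> by \<open>T x - y\<close>.
      The dependence on \<open>y\<close> thereby moves from \<open>B\<close> to \<open>A\<close>,
      and the integral over \<open>y\<close> becomes the measure of \<open>A\<close>.\<close>
    obtain z where z: "T z = y" using orthogonal_transformation_surj[OF T] by (metis surjD)
    have *: "T (- z + x) = T x - y" for x using z lin by (simp add: linear_diff linear_add linear_neg)
    show "(\<integral>\<^sup>+x. indicator A (T x) * indicator B (T x + y) \<partial>lborel) = (\<integral>\<^sup>+x. indicator A (T x - y) * indicator B (T x) \<partial>lborel)"
      by (subst shift[of _ "- z", symmetric]) (simp_all only: *, simp_all)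
  qed
  also have "\<dots> = (\<integral>\<^sup>+x. (\<integral>\<^sup>+y. indicator A (T x - y) * indicator B (T x) \<partial>lborel) \<partial>lborel)"
    by (rule lborel_pair.Fubini') measurable
  also have "\<dots> = (\<integral>\<^sup>+x. (\<integral>\<^sup>+y. indicator A (T x - y) \<partial>lborel) * indicator B (T x) \<partial>lborel)"
    by (simp add: nn_integral_multc)
  also have "\<dots> = emeasure lborel A * emeasure lborel (T -` B)"
  proof -
    have "(\<integral>\<^sup>+y. indicator A (T x - y) \<partial>lborel) = emeasure lborel A" for x
      using flip[of "indicator A" "T x"] by simp
    moreover have "T -` B \<in> sets borel" using measurable_sets[OF Tm, of B] by simp
    ultimately show ?thesis
      by (simp add: nn_integral_cmult flip: indicator_vimage)
  qed
  finally have "emeasure lborel (T -` A) * emeasure lborel B = emeasure lborel A * emeasure lborel B"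
    unfolding TB .
  then have "emeasure lborel (T -` A) = emeasure lborel A"
    using B by (auto simp: mult.commute[of _ "emeasure lborel B"] ennreal_mult_cancel_left)
  then show "emeasure (distr lborel borel T) A = emeasure lborel A"
    by (simp add: emeasure_distr)
qed

text \<open>Coordinates with respect to two bases are functions on different index sets; this
  identifies their product measures. On a box both sides are the product of the same factors, listed
  in a different order.\<close>

lemma PiM_lborel_reindex:
  assumes \<sigma>: "bij_betw \<sigma> I J" and I: "finite I"
  shows "distr (\<Pi>\<^sub>M j\<in>J. lborel) (\<Pi>\<^sub>M i\<in>I. lborel) (\<lambda>f. \<lambda>i\<in>I. f (\<sigma> i)) = (\<Pi>\<^sub>M i\<in>I. (lborel :: real measure))"
proof -
  interpret I: product_sigma_finite "\<lambda>_::'a. lborel :: real measure" by unfold_locales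
  interpret J: product_sigma_finite "\<lambda>_::'b. lborel :: real measure" by unfold_locales
  have J: "finite J" using \<sigma> I bij_betw_finite by blast
  have \<sigma>J: "\<sigma> i \<in> J" if "i \<in> I" for i using \<sigma> that by (auto simp: bij_betw_def)
  have m: "(\<lambda>f. \<lambda>i\<in>I. f (\<sigma> i)) \<in> measurable (\<Pi>\<^sub>M j\<in>J. lborel) (\<Pi>\<^sub>M i\<in>I. (lborel :: real measure))"
    using \<sigma>J by (intro measurable_restrict measurable_component_singleton)
  show ?thesis
  proof (rule I.PiM_eqI[OF I])
    fix A :: "'a \<Rightarrow> real set" assume A: "\<And>i. i \<in> I \<Longrightarrow> A i \<in> sets lborel"
    let ?\<tau> = "inv_into I \<sigma>"
    have \<tau>: "?\<tau> j \<in> I" "\<sigma> (?\<tau> j) = j" if "j \<in> J" for j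
      using that \<sigma> by (auto simp: bij_betw_def inv_into_into f_inv_into_f)
    have \<tau>\<sigma>: "?\<tau> (\<sigma> i) = i" if "i \<in> I" for i
      using that \<sigma> by (simp add: bij_betw_def)
    have "(\<lambda>f. \<lambda>i\<in>I. f (\<sigma> i)) -` (Pi\<^sub>E I A) \<inter> space (\<Pi>\<^sub>M j\<in>J. lborel) = Pi\<^sub>E J (\<lambda>j. A (?\<tau> j))"
      using \<tau> \<tau>\<sigma> \<sigma>J by (force simp: space_PiM PiE_iff)
    then have "emeasure (distr (\<Pi>\<^sub>M j\<in>J. lborel) (\<Pi>\<^sub>M i\<in>I. lborel) (\<lambda>f. \<lambda>i\<in>I. f (\<sigma> i))) (Pi\<^sub>E I A)
        = emeasure (\<Pi>\<^sub>M j\<in>J. lborel) (Pi\<^sub>E J (\<lambda>j. A (?\<tau> j)))"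
      using A I by (subst emeasure_distr[OF m]) (auto intro!: sets_PiM_I_finite)
    also have "\<dots> = (\<Prod>j\<in>J. emeasure lborel (A (?\<tau> j)))"
      using A \<tau> by (intro J.emeasure_PiM J) auto
    also have "\<dots> = (\<Prod>i\<in>I. emeasure lborel (A i))"
      using prod.reindex_bij_betw[OF \<sigma>, of "\<lambda>j. emeasure lborel (A (?\<tau> j))"] \<tau>\<sigma> by (simp cong: prod.cong)
    finally show "emeasure (distr (\<Pi>\<^sub>M j\<in>J. lborel) (\<Pi>\<^sub>M i\<in>I. lborel) (\<lambda>f. \<lambda>i\<in>I. f (\<sigma> i))) (Pi\<^sub>E I A)
        = (\<Prod>i\<in>I. emeasure lborel (A i))" .
  qed simp
qed

lemma orthonormal_basis_finite:
  fixes B :: "'a::euclidean_space set"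
  assumes "orthonormal_basis S B"
  shows "independent B" "finite B" "card B = dim S"
proof -
  have "0 \<notin> B" using assms unfolding orthonormal_basis_def by force
  then show ind: "independent B"
    using assms pairwise_orthogonal_independent unfolding orthonormal_basis_def by blast
  then show "finite B" by (rule independent_imp_finite)
  show "card B = dim S"
    using dim_span_eq_card_independent[OF ind] assms unfolding orthonormal_basis_def by simp
qed

lemma lincomb_borel_measurable [measurable]:
  fixes S :: "'a::euclidean_space set"
  shows "(\<lambda>f. \<Sum>b\<in>S. f b *\<^sub>R b) \<in> borel_measurable (\<Pi>\<^sub>M b\<in>S. (lborel :: real measure))"
  by (intro borel_measurable_sum borel_measurable_scaleR)
     (auto intro!: measurable_component_singleton)

text \<open>A bijection from \<open>Basis\<close> to \<open>B\<close> extends to an orthogonal map,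
  so the claim is rotation invariance followed by a relabelling of coordinates.\<close>

lemma lborel_eq_orthonormal_basis:
  fixes B :: "'a::euclidean_space set"
  assumes B: "orthonormal_basis UNIV B"
  shows "distr (\<Pi>\<^sub>M b\<in>B. lborel) borel (\<lambda>f. \<Sum>b\<in>B. f b *\<^sub>R b) = lborel"
proof -
  have fin: "finite B" "card B = DIM('a)"
    using orthonormal_basis_finite[OF B] by auto
  then obtain \<sigma> where \<sigma>: "bij_betw \<sigma> (Basis :: 'a set) B"
    using finite_same_card_bij[OF finite_Basis fin(1) fin(2)[symmetric]] by blast
  define T where "T x = (\<Sum>i\<in>Basis. (x \<bullet> i) *\<^sub>R \<sigma> i)" for x
  have \<sigma>B: "\<sigma> i \<in> B" if "i \<in> Basis" for i using \<sigma> that by (auto simp: bij_betw_def)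
  have inner_\<sigma>: "\<sigma> i \<bullet> \<sigma> j = (if i = j then 1 else 0)" if "i \<in> Basis" "j \<in> Basis" for i j
  proof (cases "i = j")
    case True
    then show ?thesis using B \<sigma>B[OF that(1)] unfolding orthonormal_basis_def by (simp add: norm_eq_1)
  next
    case False
    then have "\<sigma> i \<noteq> \<sigma> j" using \<sigma> that by (auto simp: bij_betw_def inj_on_def)
    then show ?thesis using False B \<sigma>B that unfolding orthonormal_basis_def pairwise_def orthogonal_def by auto
  qed
  have linT: "linear T"
    unfolding T_def by (intro linearI) (simp_all add: inner_add_left scaleR_add_left sum.distrib scaleR_sum_right)
  have "T x \<bullet> T x = x \<bullet> x" for x
  proof -
    have "T x \<bullet> \<sigma> i = x \<bullet> i" if i: "i \<in> Basis" for i
    proof -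
      have "T x \<bullet> \<sigma> i = (\<Sum>j\<in>Basis. if j = i then x \<bullet> j else 0)"
        unfolding T_def inner_sum_left using i by (intro sum.cong) (auto simp: inner_\<sigma>)
      then show ?thesis using i by simp
    qed
    then have "T x \<bullet> T x = (\<Sum>i\<in>Basis. (x \<bullet> i) * (x \<bullet> i))"
      by (subst (2) T_def) (simp add: inner_sum_right)
    then show ?thesis by (simp add: euclidean_inner[of x x])
  qed
  then have "orthogonal_transformation T"
    using linT by (auto simp: orthogonal_transformation norm_eq_sqrt_inner)
  then have "lborel = distr lborel borel T"
    by (rule lborel_distr_orthogonal_transformation[symmetric])
  also have "\<dots> = distr (distr (\<Pi>\<^sub>M b\<in>Basis. lborel) borel (\<lambda>f. \<Sum>b\<in>Basis. f b *\<^sub>R b)) borel T"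
    by (simp flip: lborel_eq)
  also have "\<dots> = distr (\<Pi>\<^sub>M b\<in>Basis. lborel) borel (\<lambda>f. \<Sum>i\<in>Basis. f i *\<^sub>R \<sigma> i)"
  proof (subst distr_distr)
    show "T \<in> borel_measurable borel"
      using linT by (intro borel_measurable_continuous_onI linear_continuous_on) (simp add: linear_conv_bounded_linear)
    have "(T \<circ> (\<lambda>f. \<Sum>b\<in>Basis. f b *\<^sub>R b)) = (\<lambda>f. \<Sum>i\<in>Basis. f i *\<^sub>R \<sigma> i)"
      by (auto simp: T_def cong: sum.cong)
    then show "distr (Pi\<^sub>M Basis (\<lambda>b. lborel)) borel (T \<circ> (\<lambda>f. \<Sum>b\<in>Basis. f b *\<^sub>R b)) =
      distr (Pi\<^sub>M Basis (\<lambda>b. lborel)) borel (\<lambda>f. \<Sum>i\<in>Basis. f i *\<^sub>R \<sigma> i)" by simp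
  qed measurable
  also have "\<dots> = distr (distr (\<Pi>\<^sub>M j\<in>B. lborel) (\<Pi>\<^sub>M i\<in>Basis. lborel) (\<lambda>f. \<lambda>i\<in>Basis. f (\<sigma> i))) borel (\<lambda>f. \<Sum>i\<in>Basis. f i *\<^sub>R \<sigma> i)"
    by (simp add: PiM_lborel_reindex[OF \<sigma>])
  also have "\<dots> = distr (\<Pi>\<^sub>M j\<in>B. lborel) borel (\<lambda>f. \<Sum>b\<in>B. f b *\<^sub>R b)"
  proof (subst distr_distr)
    show "(\<lambda>f. \<Sum>i\<in>Basis. f i *\<^sub>R \<sigma> i) \<in> borel_measurable (\<Pi>\<^sub>M i\<in>Basis. (lborel::real measure))"
      by (intro borel_measurable_sum borel_measurable_scaleR) (auto intro!: measurable_component_singleton)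
    show "(\<lambda>f. \<lambda>i\<in>Basis. f (\<sigma> i)) \<in> measurable (\<Pi>\<^sub>M j\<in>B. lborel) (\<Pi>\<^sub>M i\<in>Basis. (lborel :: real measure))"
      using \<sigma>B by (intro measurable_restrict measurable_component_singleton)
    have "(\<lambda>f. \<Sum>i\<in>Basis. f i *\<^sub>R \<sigma> i) \<circ> (\<lambda>f. \<lambda>i\<in>Basis. f (\<sigma> i)) = (\<lambda>f :: 'a \<Rightarrow> real. \<Sum>b\<in>B. f b *\<^sub>R b)"
    proof
      fix f :: "'a \<Rightarrow> real"
      show "((\<lambda>f. \<Sum>i\<in>Basis. f i *\<^sub>R \<sigma> i) \<circ> (\<lambda>f. \<lambda>i\<in>Basis. f (\<sigma> i))) f = (\<Sum>b\<in>B. f b *\<^sub>R b)"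
        using sum.reindex_bij_betw[OF \<sigma>, of "\<lambda>b. f b *\<^sub>R b"] by simp
    qed
    then show "distr (Pi\<^sub>M B (\<lambda>j. lborel)) borel ((\<lambda>f. \<Sum>i\<in>Basis. f i *\<^sub>R \<sigma> i) \<circ> (\<lambda>f. \<lambda>i\<in>Basis. f (\<sigma> i))) =
      distr (Pi\<^sub>M B (\<lambda>j. lborel)) borel (\<lambda>f :: 'a \<Rightarrow> real. \<Sum>b\<in>B. f b *\<^sub>R b)" by simp
  qed
  finally show ?thesis ..
qed

section \<open>Volumes of hyperplane sections\<close>

lemma emeasure_distr_eq_nn_integral:
  assumes "h \<in> measurable M N" "X \<in> sets N"
  shows "emeasure (distr M N h) X = (\<integral>\<^sup>+c. indicator X (h c) \<partial>M)"
proof -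
  have "emeasure (distr M N h) X = (\<integral>\<^sup>+x. indicator X x \<partial>distr M N h)"
    using assms by simp
  also have "\<dots> = (\<integral>\<^sup>+c. indicator X (h c) \<partial>M)"
    using assms by (intro nn_integral_distr) auto
  finally show ?thesis .
qed

lemma orthonormal_basis_insert_normal:
  fixes u :: "'a::euclidean_space"
  assumes B: "orthonormal_basis (hyperplane u) B" and u: "norm u = 1"
  shows "u \<notin> B" "orthonormal_basis UNIV (insert u B)"
proof -
  have uu: "u \<bullet> u = 1" using u by (simp add: norm_eq_1)
  have perp: "b \<bullet> u = 0" if "b \<in> B" for b
    using B that span_superset[of B] unfolding orthonormal_basis_def hyperplane_def by auto
  with uu show "u \<notin> B" by force
  have "x \<in> span (insert u B)" for x
  proof -
    have "x - (x \<bullet> u) *\<^sub>R u \<in> hyperplane u"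
      using uu by (simp add: hyperplane_def inner_diff_left)
    then have "x - (x \<bullet> u) *\<^sub>R u \<in> span B" using B by (simp add: orthonormal_basis_def)
    then show ?thesis by (auto simp: span_insert)
  qed
  then show "orthonormal_basis UNIV (insert u B)"
    using B u perp unfolding orthonormal_basis_def
    by (auto simp: pairwise_insert orthogonal_def inner_commute)
qed

text \<open>Thickening by a unit segment expresses the measure on the hyperplane through \<open>lborel\<close>;
  the right-hand side does not mention the basis.\<close>

lemma emeasure_hyperplane_thickening:
  fixes u :: "'a::euclidean_space"
  assumes B: "orthonormal_basis (hyperplane u) B" and u: "norm u = 1" and X[measurable]: "X \<in> sets borel"
  shows "emeasure (distr (\<Pi>\<^sub>M b\<in>B. lborel) borel (\<lambda>f. \<Sum>b\<in>B. f b *\<^sub>R b)) X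
    = emeasure lborel {z. 0 \<le> z \<bullet> u \<and> z \<bullet> u \<le> 1 \<and> z - (z \<bullet> u) *\<^sub>R u \<in> X}"
proof -
  interpret product_sigma_finite "\<lambda>_::'a. lborel :: real measure" by unfold_locales
  have fin: "finite B" using orthonormal_basis_finite[OF B] by simp
  have uu: "u \<bullet> u = 1" using u by (simp add: norm_eq_1)
  have perp: "b \<bullet> u = 0" if "b \<in> B" for b
    using B that span_superset[of B] unfolding orthonormal_basis_def hyperplane_def by auto
  note uB = orthonormal_basis_insert_normal[OF B u]
  define Z where "Z = {z. 0 \<le> z \<bullet> u \<and> z \<bullet> u \<le> 1 \<and> z - (z \<bullet> u) *\<^sub>R u \<in> X}"
  have [measurable]: "Z \<in> sets borel" unfolding Z_def by measurable
  have upd: "(\<Sum>a\<in>insert u B. (c(u := y)) a *\<^sub>R a) = (\<Sum>a\<in>B. c a *\<^sub>R a) + y *\<^sub>R u" for c and y :: real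
  proof -
    have "(\<Sum>a\<in>B. (c(u := y)) a *\<^sub>R a) = (\<Sum>a\<in>B. c a *\<^sub>R a)"
      using uB(1) by (intro sum.cong) auto
    then show ?thesis using uB(1) fin by (simp add: add.commute)
  qed
  \<comment> \<open>\<open>B\<close> is orthogonal to \<open>u\<close>, so \<open>y\<close> is the
    height over the hyperplane and the thickened set is a product, whose second factor has length
    one.\<close>
  have ind: "indicator Z ((\<Sum>a\<in>B. c a *\<^sub>R a) + y *\<^sub>R u) = (indicator X (\<Sum>a\<in>B. c a *\<^sub>R a) * indicator {0..1} y :: ennreal)" for c y
  proof -
    have "(\<Sum>a\<in>B. c a *\<^sub>R a) \<bullet> u = 0" using perp by (simp add: inner_sum_left)
    then show ?thesis using uu by (auto simp: Z_def indicator_def inner_add_left)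
  qed
  have "emeasure lborel Z = emeasure (distr (\<Pi>\<^sub>M b\<in>insert u B. lborel) borel (\<lambda>f. \<Sum>b\<in>insert u B. f b *\<^sub>R b)) Z"
    by (simp only: lborel_eq_orthonormal_basis[OF uB(2)])
  also have "\<dots> = (\<integral>\<^sup>+c. indicator Z (\<Sum>b\<in>insert u B. c b *\<^sub>R b) \<partial>(\<Pi>\<^sub>M b\<in>insert u B. lborel))"
    by (intro emeasure_distr_eq_nn_integral) simp_all
  also have "\<dots> = (\<integral>\<^sup>+c. (\<integral>\<^sup>+y. indicator Z ((\<Sum>a\<in>B. c a *\<^sub>R a) + y *\<^sub>R u) \<partial>lborel) \<partial>(\<Pi>\<^sub>M b\<in>B. lborel))"
    by (subst product_nn_integral_insert[OF fin uB(1)]) (simp_all only: upd, measurable)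
  also have "\<dots> = (\<integral>\<^sup>+c. indicator X (\<Sum>a\<in>B. c a *\<^sub>R a) \<partial>(\<Pi>\<^sub>M b\<in>B. lborel))"
    unfolding ind by (simp add: nn_integral_cmult)
  also have "\<dots> = emeasure (distr (\<Pi>\<^sub>M b\<in>B. lborel) borel (\<lambda>f. \<Sum>b\<in>B. f b *\<^sub>R b)) X"
    by (intro emeasure_distr_eq_nn_integral[symmetric]) simp_all
  finally show ?thesis by (simp add: Z_def)
qed

text \<open>\<open>lborel_on\<close> uses a basis picked by \<open>SOME\<close>; the thickening
  formula transfers the value to any given basis. The intersection with the hyperplane disappears
  because the coordinate map takes its values there.\<close>

lemma section_volume_orthonormal_basis:
  fixes u :: "'a::euclidean_space"
  assumes B: "orthonormal_basis (hyperplane u) B" and u: "norm u = 1" and K: "K \<in> sets borel"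
  shows "section_volume K u = measure (distr (\<Pi>\<^sub>M b\<in>B. lborel) borel (\<lambda>f. \<Sum>b\<in>B. f b *\<^sub>R b)) K"
proof -
  let ?C = "SOME C. orthonormal_basis (hyperplane u) C"
  let ?\<mu> = "\<lambda>B. distr (\<Pi>\<^sub>M b\<in>B. lborel) borel (\<lambda>f :: 'a \<Rightarrow> real. \<Sum>b\<in>B. f b *\<^sub>R b)"
  have C: "orthonormal_basis (hyperplane u) ?C"
    using B by (rule someI)
  have "closed (hyperplane u)"
    unfolding hyperplane_def by (intro closed_Collect_eq continuous_intros)
  then have X: "K \<inter> hyperplane u \<in> sets borel" using K by auto
  have "emeasure (?\<mu> ?C) (K \<inter> hyperplane u) = emeasure (?\<mu> B) (K \<inter> hyperplane u)"
    by (simp only: emeasure_hyperplane_thickening[OF C u X] emeasure_hyperplane_thickening[OF B u X])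
  also have "\<dots> = emeasure (?\<mu> B) K"
  proof -
    have "(\<Sum>b\<in>B. f b *\<^sub>R b) \<in> hyperplane u" for f
    proof -
      have "(\<Sum>b\<in>B. f b *\<^sub>R b) \<in> span B" by (intro span_sum span_scale span_base)
      then show ?thesis using B by (simp add: orthonormal_basis_def)
    qed
    then have "(\<lambda>f. \<Sum>b\<in>B. f b *\<^sub>R b) -` (K \<inter> hyperplane u) = (\<lambda>f. \<Sum>b\<in>B. f b *\<^sub>R b) -` K"
      by auto
    then show ?thesis using K X by (simp add: emeasure_distr)
  qed
  finally show ?thesis
    unfolding section_volume_def lborel_on_def Let_def measure_def by simp
qed

text \<open>Each coordinate contributes one factor \<open>\<bar>s\<bar>\<close>. The base point
  \<open>z\<close> is kept arbitrary so that the coordinate split off in the induction can be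
  absorbed into it.\<close>

lemma nn_integral_lincomb_scale:
  fixes S :: "'a::euclidean_space set" and g :: "'a \<Rightarrow> ennreal"
  assumes "finite S" and s: "s \<noteq> 0" and [measurable]: "g \<in> borel_measurable borel"
  shows "(\<integral>\<^sup>+c. g (z + (\<Sum>b\<in>S. c b *\<^sub>R b)) \<partial>(\<Pi>\<^sub>M b\<in>S. lborel))
    = ennreal (\<bar>s\<bar> ^ card S) * (\<integral>\<^sup>+c. g (z + s *\<^sub>R (\<Sum>b\<in>S. c b *\<^sub>R b)) \<partial>(\<Pi>\<^sub>M b\<in>S. lborel))"
  using assms(1)
proof (induction S arbitrary: z rule: finite_induct)
  case empty
  show ?case by (simp add: PiM_empty)
next
  case (insert a S)
  interpret product_sigma_finite "\<lambda>_::'a. lborel :: real measure" by unfold_locales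
  have upd: "(\<Sum>b\<in>insert a S. (c(a := y)) b *\<^sub>R b) = y *\<^sub>R a + (\<Sum>b\<in>S. c b *\<^sub>R b)" for c and y :: real
  proof -
    have "(\<Sum>b\<in>S. (c(a := y)) b *\<^sub>R b) = (\<Sum>b\<in>S. c b *\<^sub>R b)"
      using insert.hyps by (intro sum.cong) auto
    then show ?thesis using insert.hyps by simp
  qed
  let ?P = "\<Pi>\<^sub>M b\<in>S. (lborel :: real measure)"
  interpret P: sigma_finite_measure ?P using insert.hyps(1) by (rule sigma_finite)
  define G where "G y = (\<integral>\<^sup>+c. g (z + y *\<^sub>R a + s *\<^sub>R (\<Sum>b\<in>S. c b *\<^sub>R b)) \<partial>?P)" for y
  have [measurable]: "G \<in> borel_measurable borel"
    unfolding G_def by measurable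
  have "(\<integral>\<^sup>+c. g (z + (\<Sum>b\<in>insert a S. c b *\<^sub>R b)) \<partial>(\<Pi>\<^sub>M b\<in>insert a S. lborel))
      = (\<integral>\<^sup>+y. (\<integral>\<^sup>+c. g (z + y *\<^sub>R a + (\<Sum>b\<in>S. c b *\<^sub>R b)) \<partial>?P) \<partial>lborel)"
    by (subst product_nn_integral_insert_rev[OF insert.hyps]) (simp_all only: upd add.assoc, measurable)
  also have "\<dots> = (\<integral>\<^sup>+y. ennreal (\<bar>s\<bar> ^ card S) * G y \<partial>lborel)"
    by (simp only: insert.IH G_def)
  also have "\<dots> = ennreal (\<bar>s\<bar> ^ card S) * (\<integral>\<^sup>+y. G y \<partial>lborel)"
    by (simp add: nn_integral_cmult)
  also have "(\<integral>\<^sup>+y. G y \<partial>lborel) = ennreal \<bar>s\<bar> * (\<integral>\<^sup>+y. G (s * y) \<partial>lborel)"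
    using nn_integral_real_affine[of G s 0] s by simp
  also have "(\<integral>\<^sup>+y. G (s * y) \<partial>lborel)
      = (\<integral>\<^sup>+y. (\<integral>\<^sup>+c. g (z + s *\<^sub>R (y *\<^sub>R a + (\<Sum>b\<in>S. c b *\<^sub>R b))) \<partial>?P) \<partial>lborel)"
    by (simp add: G_def scaleR_add_right add.assoc)
  also have "\<dots> = (\<integral>\<^sup>+c. g (z + s *\<^sub>R (\<Sum>b\<in>insert a S. c b *\<^sub>R b)) \<partial>(\<Pi>\<^sub>M b\<in>insert a S. lborel))"
    by (subst product_nn_integral_insert_rev[OF insert.hyps]) (simp_all only: upd, measurable)
  finally show ?case
    using insert.hyps by (simp add: ennreal_mult ac_simps del: sum.insert)
qed

lemma nn_integral_abs_power:
  assumes "0 \<le> a"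
  shows "(\<integral>\<^sup>+y. ennreal (\<bar>y\<bar> ^ m) * indicator {- a..a} y \<partial>lborel) = ennreal (2 / (real m + 1) * a ^ (m + 1))"
proof -
  have half: "(\<integral>\<^sup>+y. ennreal (\<bar>y\<bar> ^ m) * indicator {0..a} y \<partial>lborel) = ennreal (a ^ (m + 1) / (real m + 1))"
  proof -
    have "(\<integral>\<^sup>+y. ennreal (\<bar>y\<bar> ^ m) * indicator {0..a} y \<partial>lborel) = (\<integral>\<^sup>+y. ennreal (y ^ m) * indicator {0..a} y \<partial>lborel)"
      by (intro nn_integral_cong) (auto split: split_indicator)
    also have "\<dots> = ennreal (a ^ (m + 1) / (real m + 1) - 0 ^ (m + 1) / (real m + 1))"
    proof (rule nn_integral_FTC_Icc)
      show "((\<lambda>y. y ^ (m + 1) / (real m + 1)) has_real_derivative y ^ m) (at y)" for y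
        using DERIV_cdivide[OF DERIV_pow[of "Suc m" y], of "real m + 1"] by (simp add: add.commute)
    qed (use assms in auto)
    finally show ?thesis by simp
  qed
  have "(\<integral>\<^sup>+y. ennreal (\<bar>y\<bar> ^ m) * indicator {- a..a} y \<partial>lborel)
     = (\<integral>\<^sup>+y. ennreal (\<bar>y\<bar> ^ m) * indicator {0..a} y + ennreal (\<bar>- y\<bar> ^ m) * indicator {0..a} (- y) \<partial>lborel)"
  \<comment> \<open>The two halves overlap at 0, where the integrand is 1 if \<open>m = 0\<close>;
    hence equality almost everywhere.\<close>
  proof (rule nn_integral_cong_AE)
    have "AE y in lborel. y \<noteq> (0::real)" by (rule AE_lborel_singleton)
    then show "AE y in lborel. ennreal (\<bar>y\<bar> ^ m) * indicator {- a..a} y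
      = ennreal (\<bar>y\<bar> ^ m) * indicator {0..a} y + ennreal (\<bar>- y\<bar> ^ m) * indicator {0..a} (- y)"
      by eventually_elim (use assms in \<open>auto simp: indicator_def\<close>)
  qed
  also have "\<dots> = (\<integral>\<^sup>+y. ennreal (\<bar>y\<bar> ^ m) * indicator {0..a} y \<partial>lborel) + (\<integral>\<^sup>+y. ennreal (\<bar>- y\<bar> ^ m) * indicator {0..a} (- y) \<partial>lborel)"
    by (intro nn_integral_add) measurable
  also have "(\<integral>\<^sup>+y. ennreal (\<bar>- y\<bar> ^ m) * indicator {0..a} (- y) \<partial>lborel) = (\<integral>\<^sup>+y. ennreal (\<bar>y\<bar> ^ m) * indicator {0..a} y \<partial>lborel)"
    using nn_integral_real_affine[of "\<lambda>y. ennreal (\<bar>y\<bar> ^ m) * indicator {0..a} y" "- 1" 0] by simp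
  finally show ?thesis
    unfolding half using assms by (simp flip: ennreal_plus)
qed

text \<open>Substitute \<open>c \<mapsto> y c\<close> in the directions of \<open>S\<close>, where \<open>y\<close> is the coordinate along \<open>v\<close>;
  for fixed \<open>c\<close> the integrand is then \<open>\<bar>y\<bar> ^ card S\<close> on a symmetric interval.\<close>

lemma emeasure_unit_ball_section:
  fixes S :: "'a::euclidean_space set" and N :: "'a \<Rightarrow> real"
  assumes fin: "finite S" and v: "v \<notin> S"
    and N[measurable]: "N \<in> borel_measurable borel" and hom: "\<And>c x. N (c *\<^sub>R x) = \<bar>c\<bar> * N x"
    and pos: "\<And>c. 0 < N (v + (\<Sum>b\<in>S. c b *\<^sub>R b))"
  shows "emeasure (distr (\<Pi>\<^sub>M b\<in>insert v S. lborel) borel (\<lambda>f. \<Sum>b\<in>insert v S. f b *\<^sub>R b)) {x. N x \<le> 1}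
    = ennreal (2 / (real (card S) + 1)) *
      (\<integral>\<^sup>+c. ennreal (N (v + (\<Sum>b\<in>S. c b *\<^sub>R b)) powr - (real (card S) + 1)) \<partial>(\<Pi>\<^sub>M b\<in>S. lborel))"
proof -
  interpret product_sigma_finite "\<lambda>_::'a. lborel :: real measure" by unfold_locales
  let ?P = "\<Pi>\<^sub>M b\<in>S. (lborel :: real measure)" and ?m = "card S"
  interpret P: sigma_finite_measure ?P using fin by (rule sigma_finite)
  interpret PP: pair_sigma_finite ?P lborel ..
  define X where "X = {x. N x \<le> 1}"
  have [measurable]: "X \<in> sets borel" unfolding X_def by measurable
  have upd: "(\<Sum>b\<in>insert v S. (c(v := y)) b *\<^sub>R b) = y *\<^sub>R v + (\<Sum>b\<in>S. c b *\<^sub>R b)" for c and y :: real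
  proof -
    have "(\<Sum>b\<in>S. (c(v := y)) b *\<^sub>R b) = (\<Sum>b\<in>S. c b *\<^sub>R b)"
      using v by (intro sum.cong) auto
    then show ?thesis using v fin by simp
  qed
  let ?z = "\<lambda>c. v + (\<Sum>b\<in>S. c b *\<^sub>R b)"
  have "emeasure (distr (\<Pi>\<^sub>M b\<in>insert v S. lborel) borel (\<lambda>f. \<Sum>b\<in>insert v S. f b *\<^sub>R b)) X
      = (\<integral>\<^sup>+c. indicator X (\<Sum>b\<in>insert v S. c b *\<^sub>R b) \<partial>(\<Pi>\<^sub>M b\<in>insert v S. lborel))"
    by (intro emeasure_distr_eq_nn_integral) simp_all
  also have "\<dots> = (\<integral>\<^sup>+y. (\<integral>\<^sup>+c. indicator X (y *\<^sub>R v + (\<Sum>b\<in>S. c b *\<^sub>R b)) \<partial>?P) \<partial>lborel)"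
    by (subst product_nn_integral_insert_rev[OF fin v]) (simp_all only: upd, measurable)
  also have "\<dots> = (\<integral>\<^sup>+y. (\<integral>\<^sup>+c. ennreal (\<bar>y\<bar> ^ ?m) * indicator X (y *\<^sub>R ?z c) \<partial>?P) \<partial>lborel)"
  \<comment> \<open>The scaling formula requires a nonzero factor, so the null set
    \<open>y = 0\<close> is excluded.\<close>
  proof (rule nn_integral_cong_AE)
    have "AE y in lborel. y \<noteq> (0::real)" by (rule AE_lborel_singleton)
    then show "AE y in lborel. (\<integral>\<^sup>+c. indicator X (y *\<^sub>R v + (\<Sum>b\<in>S. c b *\<^sub>R b)) \<partial>?P)
      = (\<integral>\<^sup>+c. ennreal (\<bar>y\<bar> ^ ?m) * indicator X (y *\<^sub>R ?z c) \<partial>?P)"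
    proof eventually_elim
      fix y :: real assume y: "y \<noteq> 0"
      show "(\<integral>\<^sup>+c. indicator X (y *\<^sub>R v + (\<Sum>b\<in>S. c b *\<^sub>R b)) \<partial>?P)
        = (\<integral>\<^sup>+c. ennreal (\<bar>y\<bar> ^ ?m) * indicator X (y *\<^sub>R ?z c) \<partial>?P)"
        using nn_integral_lincomb_scale[OF fin y, of "indicator X" "y *\<^sub>R v"]
        by (simp add: scaleR_add_right nn_integral_cmult)
    qed
  qed
  also have "\<dots> = (\<integral>\<^sup>+c. (\<integral>\<^sup>+y. ennreal (\<bar>y\<bar> ^ ?m) * indicator X (y *\<^sub>R ?z c) \<partial>lborel) \<partial>?P)"
    by (rule PP.Fubini') measurable
  also have "\<dots> = (\<integral>\<^sup>+c. ennreal (2 / (real ?m + 1)) * ennreal (N (?z c) powr - (real ?m + 1)) \<partial>?P)"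
  proof (rule nn_integral_cong)
    fix c
    \<comment> \<open>Along the line through \<open>?z c\<close> the unit ball of \<open>N\<close>
      is an interval of this half-length; integrating \<open>\<bar>y\<bar> ^ ?m\<close> over it
      raises the exponent to \<open>?m + 1\<close>.\<close>
    let ?a = "1 / N (?z c)"
    have "(\<integral>\<^sup>+y. ennreal (\<bar>y\<bar> ^ ?m) * indicator X (y *\<^sub>R ?z c) \<partial>lborel)
        = (\<integral>\<^sup>+y. ennreal (\<bar>y\<bar> ^ ?m) * indicator {- ?a..?a} y \<partial>lborel)"
    proof -
      have "y *\<^sub>R ?z c \<in> X \<longleftrightarrow> y \<in> {- ?a..?a}" for y
      proof -
        have "y *\<^sub>R ?z c \<in> X \<longleftrightarrow> \<bar>y\<bar> \<le> ?a"
          unfolding X_def mem_Collect_eq hom using pos[of c] by (simp add: pos_le_divide_eq)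
        then show ?thesis by auto
      qed
      then show ?thesis by (simp only: indicator_def)
    qed
    also have "\<dots> = ennreal (2 / (real ?m + 1) * ?a ^ (?m + 1))"
      using pos[of c] by (intro nn_integral_abs_power) simp
    also have "?a ^ (?m + 1) = N (?z c) powr - (real ?m + 1)"
      using pos[of c] by (simp add: powr_minus powr_realpow power_one_over divide_inverse power_inverse powr_add powr_diff)
    finally show "(\<integral>\<^sup>+y. ennreal (\<bar>y\<bar> ^ ?m) * indicator X (y *\<^sub>R ?z c) \<partial>lborel)
      = ennreal (2 / (real ?m + 1)) * ennreal (N (?z c) powr - (real ?m + 1))"
      by (subst ennreal_mult[symmetric]) simp_all
  qed
  also have "\<dots> = ennreal (2 / (real ?m + 1)) * (\<integral>\<^sup>+c. ennreal (N (?z c) powr - (real ?m + 1)) \<partial>?P)"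
    by (intro nn_integral_cmult) measurable
  finally show ?thesis unfolding X_def .
qed

section \<open>Minkowski functionals and intersection bodies\<close>

text \<open>One inequality, shown for all \<open>c\<close> and \<open>x\<close>, yields the other
  when applied to \<open>1 / c\<close> and \<open>c *\<^sub>R x\<close>. Symmetry of
  \<open>K\<close> covers negative \<open>c\<close>.\<close>

lemma Minkowski_scaleR:
  fixes K :: "'a::euclidean_space set"
  assumes K: "compact K" "absorbing K" "origin_symmetric K"
  shows "Minkowski K (c *\<^sub>R x) = \<bar>c\<bar> * Minkowski K x"
proof -
  note M = Minkowski_attained[OF K(1,2)]
  have le: "Minkowski K (c *\<^sub>R x) \<le> \<bar>c\<bar> * Minkowski K x" for c x
  proof -
    obtain k where k: "k \<in> K" "x = Minkowski K x *\<^sub>R k" using M(2)[of x] by blast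
    have sk: "(if 0 \<le> c then k else - k) \<in> K" using K(3) k(1) by (simp add: origin_symmetric_def)
    have "c *\<^sub>R x = (c * Minkowski K x) *\<^sub>R k" by (subst k(2)) simp
    also have "\<dots> = (\<bar>c\<bar> * Minkowski K x) *\<^sub>R (if 0 \<le> c then k else - k)" by simp
    finally show ?thesis using M(1)[of x] sk by (intro M(3) image_eqI) simp_all
  qed
  show ?thesis
  proof (cases "c = 0")
    case True
    then show ?thesis using le[of 0 x] M(1)[of 0] by simp
  next
    case False
    have "Minkowski K x \<le> \<bar>1 / c\<bar> * Minkowski K (c *\<^sub>R x)"
      using le[of "1 / c" "c *\<^sub>R x"] False by simp
    then have "\<bar>c\<bar> * Minkowski K x \<le> Minkowski K (c *\<^sub>R x)"
      using False by (simp add: abs_divide pos_le_divide_eq mult.commute)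
    with le[of c x] show ?thesis by simp
  qed
qed

lemma Minkowski_pos:
  fixes K :: "'a::euclidean_space set"
  assumes "compact K" "absorbing K" "x \<noteq> 0"
  shows "0 < Minkowski K x"
  using Minkowski_attained(1,2)[OF assms(1,2), of x] assms(3)
  by (cases "Minkowski K x = 0") (auto simp: image_iff)

lemma Minkowski_le_one_iff:
  fixes K :: "'a::euclidean_space set"
  assumes K: "compact K" "absorbing K" "star_shaped K"
  shows "Minkowski K x \<le> 1 \<longleftrightarrow> x \<in> K"
proof
  note M = Minkowski_attained[OF K(1,2)]
  assume le: "Minkowski K x \<le> 1"
  obtain k where k: "k \<in> K" "x = Minkowski K x *\<^sub>R k" using M(2)[of x] by blast
  have "x \<in> closed_segment 0 k"
    using le M(1)[of x] k(2) by (auto simp: in_segment intro!: exI[of _ "Minkowski K x"])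
  then show "x \<in> K" using K(3) k(1) unfolding star_shaped_def by blast
next
  assume "x \<in> K"
  then show "Minkowski K x \<le> 1"
    using Minkowski_attained(3)[OF K(1,2), of 1 x] by simp
qed

lemma gauge_on_Minkowski:
  fixes K :: "'a::euclidean_space set"
  assumes K: "origin_symmetric K" "p_convex p K" and p: "0 < p" "p \<le> 1"
  shows "gauge_on UNIV p (\<lambda>x. Minkowski K x powr p)"
proof -
  have c: "compact K" "absorbing K" using K unfolding p_convex_def body_def by auto
  show ?thesis
    unfolding gauge_on_def
    using K p Minkowski_pos[OF c] Minkowski_attained(1)[OF c]
    by (auto simp: Minkowski_scaleR[OF c K(1)] powr_mult p_convex_def less_imp_neq[THEN not_sym])
qed

text \<open>The \<open>p\<close>-th power is a gauge on the whole space, hence continuous, and the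
  functional is recovered from it by the power \<open>1 / p\<close>.\<close>

lemma Minkowski_borel_measurable:
  fixes K :: "'a::euclidean_space set"
  assumes K: "origin_symmetric K" "p_convex p K" and p: "0 < p" "p \<le> 1"
  shows "Minkowski K \<in> borel_measurable borel"
proof -
  have c: "compact K" "absorbing K" using K unfolding p_convex_def body_def by auto
  have [measurable]: "(\<lambda>x. Minkowski K x powr p) \<in> borel_measurable borel"
    by (rule gauge_on_borel_measurable[OF gauge_on_Minkowski[OF assms]]) auto
  have "Minkowski K = (\<lambda>x. (Minkowski K x powr p) powr (1 / p))"
    using p Minkowski_attained(1)[OF c] by (simp add: powr_powr fun_eq_iff)
  also have "\<dots> \<in> borel_measurable borel" by measurable
  finally show ?thesis .
qed

text \<open>For nonzero \<open>x\<close>, lying in a dilate of the intersection body fixes the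
  direction by uniqueness of polar coordinates; only the length remains to be compared. Positive
  section volume makes the quotient the attained minimum.\<close>

lemma Minkowski_intersection_body:
  assumes pos: "\<And>u. norm u = 1 \<Longrightarrow> 0 < section_volume K u" and x: "x \<noteq> 0"
  shows "Minkowski (intersection_body K) x = norm x / section_volume K (x /\<^sub>R norm x)"
  unfolding Minkowski_def
proof (rule cInf_eq_minimum)
  let ?u = "x /\<^sub>R norm x"
  have u: "norm ?u = 1" using x by simp
  note s = pos[OF u]
  have "section_volume K ?u *\<^sub>R ?u \<in> intersection_body K"
    unfolding intersection_body_def using u s by (auto intro!: exI[of _ "section_volume K ?u"] exI[of _ ?u])
  moreover have "x = (norm x / section_volume K ?u) *\<^sub>R (section_volume K ?u *\<^sub>R ?u)"
    using x s by simp
  ultimately have "x \<in> (*\<^sub>R) (norm x / section_volume K ?u) ` intersection_body K"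
    by (rule rev_image_eqI)
  then show "norm x / section_volume K ?u \<in> {l. 0 \<le> l \<and> x \<in> (*\<^sub>R) l ` intersection_body K}"
    using s by simp
  fix l assume "l \<in> {l. 0 \<le> l \<and> x \<in> (*\<^sub>R) l ` intersection_body K}"
  then obtain r v where l: "0 \<le> l" "x = l *\<^sub>R (r *\<^sub>R v)" "norm v = 1" "0 \<le> r" "r \<le> section_volume K v"
    unfolding intersection_body_def by auto
  then have n: "norm x = l * r" by simp
  then have lr: "0 < l" "0 < r" using x l by (auto simp: less_le)
  have "?u = (inverse (norm x) * (l * r)) *\<^sub>R v" by (subst (2) l(2)) simp
  also have "inverse (norm x) * (l * r) = 1" unfolding n using lr by (intro left_inverse) simp
  finally have "?u = v" by simp
  then show "norm x / section_volume K ?u \<le> l"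
    using l lr n s by (simp add: pos_divide_le_eq mult_left_mono)
qed

lemma Minkowski_intersection_body_zero: "Minkowski (intersection_body K) (0 :: 'a::euclidean_space) = 0"
  unfolding Minkowski_def
proof (rule cInf_eq_minimum)
  obtain u :: 'a where "norm u = 1" using vector_choose_size[of 1] by auto
  then have "0 \<in> intersection_body K"
    unfolding intersection_body_def using section_volume_nonneg[of K u] by (auto intro!: exI[of _ 0] exI[of _ u])
  then show "0 \<in> {l. 0 \<le> l \<and> (0::'a) \<in> (*\<^sub>R) l ` intersection_body K}" by auto
qed auto

text \<open>Beyond the inequality, \<open>p_convex\<close> asks for a star-shaped absorbing body.
  Continuity of the gauge gives closedness and an open set around the origin inside
  \<open>L\<close>; its lower bound gives boundedness. That \<open>L\<close> is its own unit
  sublevel set is a hypothesis because the functional alone does not determine the set.\<close>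

lemma p_convex_of_gauge:
  fixes L :: "'a::euclidean_space set"
  assumes g: "gauge_on UNIV q (\<lambda>x. Minkowski L x powr q)"
    and L: "L = {x. Minkowski L x \<le> 1}" and nonneg: "\<And>x. 0 \<le> Minkowski L x"
    and hom: "\<And>c x. 0 \<le> c \<Longrightarrow> Minkowski L (c *\<^sub>R x) = c * Minkowski L x"
  shows "p_convex q L"
proof -
  let ?M = "\<lambda>x. Minkowski L x powr q"
  have q: "0 < q" and sub: "\<And>x y. ?M (x + y) \<le> ?M x + ?M y"
    using g by (auto simp: gauge_on_def)
  have iff: "x \<in> L \<longleftrightarrow> ?M x \<le> 1" for x
  proof -
    have "Minkowski L x \<le> 1 \<longleftrightarrow> ?M x \<le> 1"
      using powr_mono2[of q "Minkowski L x" 1] powr_less_mono2[of q 1 "Minkowski L x"] q nonneg[of x]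
      by (auto simp: not_le[symmetric])
    then show ?thesis by (subst L) simp
  qed
  have "closed {x. ?M x \<le> 1}"
    by (intro closed_Collect_le gauge_on_continuous[OF g] continuous_on_const)
  then have "closed L" using iff by (metis (no_types, lifting) Collect_cong Collect_mem_eq)
  moreover obtain c where c: "0 < c" "\<And>x. c * norm x powr q \<le> ?M x"
    using gauge_on_lower_bound[OF g] by auto
  have "norm x \<le> (1 / c) powr (1 / q)" if "x \<in> L" for x
  proof -
    have "norm x powr q \<le> 1 / c"
      using c(2)[of x] that c(1) iff by (simp add: pos_le_divide_eq mult.commute)
    then have "(norm x powr q) powr (1 / q) \<le> (1 / c) powr (1 / q)"
      using q by (intro powr_mono2) auto
    then show ?thesis using q by (simp add: powr_powr)
  qed
  then have "bounded L" unfolding bounded_iff by blast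
  ultimately have "compact L" by (simp add: compact_eq_bounded_closed)
  moreover have "interior L \<noteq> {}"
  proof -
    have "open {x. ?M x < 1}"
      by (intro open_Collect_less gauge_on_continuous[OF g] continuous_on_const)
    moreover have "{x. ?M x < 1} \<subseteq> L" by (simp add: subset_iff iff)
    moreover have "0 \<in> {x. ?M x < 1}" using gauge_on_zero[OF g] by simp
    ultimately show ?thesis using interior_maximal[of "{x. ?M x < 1}" L] by (metis empty_iff subsetD)
  qed
  moreover have "star_shaped L"
    unfolding star_shaped_def
  proof (intro ballI subsetI)
    fix x y assume x: "x \<in> L" and "y \<in> closed_segment 0 x"
    then obtain s where s: "0 \<le> s" "s \<le> 1" "y = s *\<^sub>R x" by (auto simp: in_segment)
    have "Minkowski L x \<le> 1" using x by (subst (asm) L) simp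
    then have "Minkowski L y \<le> 1" using s nonneg[of x] by (simp add: hom mult_le_one)
    then show "y \<in> L" by (subst L) simp
  qed
  moreover have "absorbing L"
    unfolding absorbing_def
  proof
    fix x
    let ?l = "Minkowski L x + 1"
    have l: "0 < ?l" using nonneg[of x] by simp
    have "(1 / ?l) *\<^sub>R x \<in> L"
      using l by (subst L) (simp add: hom)
    then have "x \<in> (*\<^sub>R) ?l ` L" using l by (intro image_eqI[of _ _ "(1 / ?l) *\<^sub>R x"]) auto
    then show "\<exists>l\<ge>0. x \<in> (*\<^sub>R) l ` L" using l by (intro exI[of _ ?l]) simp
  qed
  ultimately show ?thesis
    using sub unfolding p_convex_def body_def by blast
qed

lemma intersection_body_eq_sublevel:
  fixes K :: "'a::euclidean_space set"
  assumes pos: "\<And>u. norm u = 1 \<Longrightarrow> 0 < section_volume K u"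
  shows "intersection_body K = {x. Minkowski (intersection_body K) x \<le> 1}"
proof (intro set_eqI)
  fix x :: 'a
  show "x \<in> intersection_body K \<longleftrightarrow> x \<in> {x. Minkowski (intersection_body K) x \<le> 1}"
  proof (cases "x = 0")
    case True
    obtain u :: 'a where "norm u = 1" using vector_choose_size[of 1] by auto
    then have "0 \<in> intersection_body K"
      unfolding intersection_body_def using section_volume_nonneg[of K u] by (auto intro!: exI[of _ 0] exI[of _ u])
    then show ?thesis using True by (simp add: Minkowski_intersection_body_zero)
  next
    case False
    let ?u = "x /\<^sub>R norm x"
    have u: "norm ?u = 1" using False by simp
    have "x \<in> intersection_body K \<longleftrightarrow> norm x \<le> section_volume K ?u"
    proof
      assume "x \<in> intersection_body K"
      then obtain r v where r: "x = r *\<^sub>R v" "norm v = 1" "0 \<le> r" "r \<le> section_volume K v"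
        unfolding intersection_body_def by blast
      with False have "norm x = r" "?u = v" by auto
      with r show "norm x \<le> section_volume K ?u" by simp
    next
      assume "norm x \<le> section_volume K ?u"
      then show "x \<in> intersection_body K"
        unfolding intersection_body_def using u False by (auto intro!: exI[of _ "norm x"] exI[of _ ?u])
    qed
    then show ?thesis
      using Minkowski_intersection_body[OF pos False] pos[OF u] by simp
  qed
qed

section \<open>Reduction to planes\<close>

text \<open>The inserted vector is the normal turned through a right angle inside the plane.
  \<open>S\<close> is the same for all \<open>a\<close> and \<open>b\<close>, so these hyperplanes
  can all be sliced along common directions.\<close>

lemma orthonormal_basis_hyperplane_in_plane:
  fixes e1 e2 :: "'a::euclidean_space"
  assumes e: "norm e1 = 1" "norm e2 = 1" "e1 \<bullet> e2 = 0"
    and S: "orthonormal_basis {z. z \<bullet> e1 = 0 \<and> z \<bullet> e2 = 0} S" and ab: "a\<^sup>2 + b\<^sup>2 = 1"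
  shows "orthonormal_basis (hyperplane (a *\<^sub>R e1 + b *\<^sub>R e2)) (insert (a *\<^sub>R e2 - b *\<^sub>R e1) S)"
    "a *\<^sub>R e2 - b *\<^sub>R e1 \<notin> S" "norm (a *\<^sub>R e1 + b *\<^sub>R e2) = 1"
proof -
  let ?u = "a *\<^sub>R e1 + b *\<^sub>R e2" and ?v = "a *\<^sub>R e2 - b *\<^sub>R e1"
  have ee: "e1 \<bullet> e1 = 1" "e2 \<bullet> e2 = 1" "e2 \<bullet> e1 = 0"
    using e by (simp_all add: norm_eq_1 inner_commute)
  have uv: "?u \<bullet> ?u = 1" "?v \<bullet> ?v = 1" "?v \<bullet> ?u = 0" "?u \<bullet> ?v = 0"
    using ee e(3) ab by (simp_all add: algebra_simps inner_add_left inner_add_right inner_diff_left inner_diff_right power2_eq_square)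
  then show "norm ?u = 1" by (simp add: norm_eq_1)
  have Sspan: "span S = {z. z \<bullet> e1 = 0 \<and> z \<bullet> e2 = 0}" using S by (simp add: orthonormal_basis_def)
  have perp: "s \<bullet> e1 = 0" "s \<bullet> e2 = 0" if "s \<in> S" for s
    using that span_base[OF that] Sspan by auto
  have pv: "s \<bullet> ?v = 0" "s \<bullet> ?u = 0" if "s \<in> S" for s
    using perp[OF that] by (simp_all add: inner_add_right inner_diff_right)
  show "?v \<notin> S" using pv(1)[of ?v] uv(2) by auto
  have "span (insert ?v S) = hyperplane ?u"
  proof (intro equalityI subsetI)
    fix z assume "z \<in> span (insert ?v S)"
    moreover have "subspace (hyperplane ?u)"
      unfolding hyperplane_def subspace_def by (simp add: inner_add_left)
    moreover have "insert ?v S \<subseteq> hyperplane ?u" using uv(3) pv(2) by (auto simp: hyperplane_def)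
    ultimately show "z \<in> hyperplane ?u" using span_minimal by blast
  next
    fix z assume "z \<in> hyperplane ?u"
    then have zu: "z \<bullet> ?u = 0" by (simp add: hyperplane_def)
    let ?w = "z - (z \<bullet> ?v) *\<^sub>R ?v"
    have w: "?w \<bullet> ?u = 0"
      by (simp only: inner_diff_left[of z] inner_scaleR_left uv zu mult_zero_right diff_self)
    have w': "?w \<bullet> ?v = 0"
      by (simp only: inner_diff_left[of z] inner_scaleR_left uv mult_1_right diff_self)
    \<comment> \<open>The inverse rotation: \<open>e1\<close> and \<open>e2\<close> are combinations
      of \<open>?u\<close> and \<open>?v\<close>, so a vector orthogonal to the latter pair lies in
      \<open>span S\<close>.\<close>
    have "a *\<^sub>R ?u - b *\<^sub>R ?v = (a\<^sup>2 + b\<^sup>2) *\<^sub>R e1" "b *\<^sub>R ?u + a *\<^sub>R ?v = (a\<^sup>2 + b\<^sup>2) *\<^sub>R e2"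
      by (simp_all add: algebra_simps power2_eq_square)
    then have e12: "e1 = a *\<^sub>R ?u - b *\<^sub>R ?v" "e2 = b *\<^sub>R ?u + a *\<^sub>R ?v" using ab by simp_all
    have "?w \<bullet> e1 = a * (?w \<bullet> ?u) - b * (?w \<bullet> ?v)"
      by (subst e12(1)) (simp only: inner_diff_right[of ?w] inner_scaleR_right)
    moreover have "?w \<bullet> e2 = b * (?w \<bullet> ?u) + a * (?w \<bullet> ?v)"
      by (subst e12(2)) (simp only: inner_add_right[of ?w] inner_scaleR_right)
    ultimately have "?w \<in> span S" using w w' Sspan by simp
    then show "z \<in> span (insert ?v S)" by (auto simp: span_insert)
  qed
  moreover have "pairwise orthogonal (insert ?v S)"
    using S pv(1) by (auto simp: orthonormal_basis_def pairwise_insert orthogonal_def inner_commute)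
  moreover have "norm ?v = 1" using uv(2) by (simp add: norm_eq_1)
  ultimately show "orthonormal_basis (hyperplane ?u) (insert ?v S)"
    using S by (auto simp: orthonormal_basis_def)
qed

lemma span_pairE:
  assumes "z \<in> span {a, b}"
  obtains k l where "z = k *\<^sub>R a + l *\<^sub>R b"
proof -
  obtain k where "z - k *\<^sub>R a \<in> span {b}" using assms by (auto simp: span_insert)
  then obtain l where "z - k *\<^sub>R a = l *\<^sub>R b" by (auto simp: span_singleton)
  then have "z = k *\<^sub>R a + l *\<^sub>R b" by (simp add: algebra_simps)
  then show ?thesis by (rule that)
qed

text \<open>Gram-Schmidt, with auxiliary vectors where \<open>x\<close> vanishes or \<open>y\<close>
  is a multiple of \<open>e1\<close>; the dimension bound provides the second direction.\<close>

lemma orthonormal_pair_spanning: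
  fixes x y :: "'a::euclidean_space"
  assumes "2 \<le> DIM('a)"
  obtains e1 e2 where "norm e1 = 1" "norm e2 = 1" "e1 \<bullet> e2 = 0" "x \<in> span {e1, e2}" "y \<in> span {e1, e2}"
proof -
  obtain e1 :: 'a where e1: "norm e1 = 1" "x \<in> span {e1}"
  proof (cases "x = 0")
    case True
    then show ?thesis using that vector_choose_size[of 1] span_zero by (metis zero_le_one)
  next
    case False
    have "x = norm x *\<^sub>R (x /\<^sub>R norm x)" using False by simp
    then have "x \<in> span {x /\<^sub>R norm x}" by (metis insertI1 span_base span_scale)
    then show ?thesis using that[of "x /\<^sub>R norm x"] False by simp
  qed
  have e11: "e1 \<bullet> e1 = 1" using e1 by (simp add: norm_eq_1)
  define y' where "y' = y - (y \<bullet> e1) *\<^sub>R e1"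
  have y': "e1 \<bullet> y' = 0" using e11 by (simp add: y'_def inner_diff_right inner_commute)
  obtain w where w: "w \<noteq> 0" "e1 \<bullet> w = 0" "y' \<in> span {w}"
  proof (cases "y' = 0")
    case True
    then show ?thesis
      using orthogonal_to_vector_exists[OF assms, of e1] that span_zero by (metis orthogonal_def)
  next
    case False
    then show ?thesis using that[of y'] y' by (simp add: span_base)
  qed
  define e2 where "e2 = w /\<^sub>R norm w"
  have "w = norm w *\<^sub>R e2" using w by (simp add: e2_def)
  then have "w \<in> span {e1, e2}" by (metis insertI1 insert_commute span_base span_scale)
  then have "span {w} \<subseteq> span {e1, e2}" by (intro span_minimal) auto
  then have "y' \<in> span {e1, e2}" using w(3) by auto
  moreover have "e1 \<in> span {e1, e2}" by (simp add: span_base)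
  ultimately have "y' + (y \<bullet> e1) *\<^sub>R e1 \<in> span {e1, e2}" by (intro span_add span_scale)
  then have "y \<in> span {e1, e2}" by (simp add: y'_def)
  moreover have "x \<in> span {e1, e2}" using e1(2) span_mono[of "{e1}" "{e1, e2}"] by auto
  ultimately show ?thesis
    using that[of e1 e2] e1 w by (simp add: e2_def)
qed

text \<open>On every plane, \<open>Minkowski (intersection_body K) powr q\<close> is, up to rotation by a right angle
  and a constant factor, the gauge obtained from \<open>Minkowski K powr p\<close> by integrating out the
  orthogonal complement of the plane.\<close>

lemma intersection_body_plane:
  fixes K :: "'a::euclidean_space set" and e1 e2 :: 'a
  assumes dim: "2 \<le> DIM('a)" and p: "0 < p" "p \<le> 1" and K: "origin_symmetric K" "p_convex p K"
    and e: "norm e1 = 1" "norm e2 = 1" "e1 \<bullet> e2 = 0"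
  defines "q \<equiv> inverse ((1 / p - 1) * (real (DIM('a)) - 1) + 1)"
  obtains \<psi> :: "'a \<Rightarrow> real" and C where "gauge_on (span {e1, e2}) q \<psi>" "0 < C"
    "\<And>a b. a\<^sup>2 + b\<^sup>2 = 1 \<Longrightarrow> 0 < section_volume K (a *\<^sub>R e1 + b *\<^sub>R e2)"
    "\<And>a b. a\<^sup>2 + b\<^sup>2 = 1 \<Longrightarrow>
      (1 / section_volume K (a *\<^sub>R e1 + b *\<^sub>R e2)) powr q = C * \<psi> (a *\<^sub>R e2 - b *\<^sub>R e1)"
proof -
  let ?N = "Minkowski K" and ?V = "span {e1, e2}"
  have c: "compact K" "absorbing K" "star_shaped K"
    using K unfolding p_convex_def body_def by auto
  have Kb: "K \<in> sets borel" using c(1) by (simp add: borel_compact)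
  have "subspace {z. z \<bullet> e1 = 0 \<and> z \<bullet> e2 = 0}"
    unfolding subspace_def by (simp add: inner_add_left)
  then obtain S where S: "orthonormal_basis {z. z \<bullet> e1 = 0 \<and> z \<bullet> e2 = 0} S"
    using orthonormal_basis_ex by blast
  note fin = orthonormal_basis_finite(2)[OF S]
  note plane = orthonormal_basis_hyperplane_in_plane[OF e S]
  have perp: "s \<bullet> e1 = 0" "s \<bullet> e2 = 0" if "s \<in> S" for s
    using S that span_base[OF that] by (auto simp: orthonormal_basis_def)
  have "e1 \<noteq> 0" using e by auto
  \<comment> \<open>The case \<open>a = 1\<close>, \<open>b = 0\<close>: \<open>insert e2 S\<close>
    is an orthonormal basis of the complement of \<open>e1\<close>, so \<open>S\<close> has two
    elements fewer than the dimension of the space.\<close>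
  then have "card (insert e2 S) = DIM('a) - 1"
    using orthonormal_basis_finite(3)[OF plane(1)[of 1 0]] dim_hyperplane[of e1]
    by (simp add: hyperplane_def inner_commute)
  then have card: "real (card S) = real (DIM('a)) - 2"
    using fin plane(2)[of 1 0] dim by simp
  define m where "m = real (card S)"
  \<comment> \<open>Chosen so that the power \<open>- \<epsilon>\<close> of
    \<open>?N x powr p\<close> is \<open>?N x powr - (m + 1)\<close>, the integrand that polar
    integration produces on a section of dimension \<open>m + 1\<close>.\<close>
  define \<epsilon> where "\<epsilon> = (m + 1) / p"
  have ep: "\<epsilon> * p = m + 1" using p by (simp add: \<epsilon>_def)
  have em: "\<epsilon> - m = 1 / q"
  proof -
    have d: "real (DIM('a)) = m + 2" using card by (simp add: m_def)
    show ?thesis unfolding q_def \<epsilon>_def d using p by (simp add: field_simps)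
  qed
  have "0 < \<epsilon> - m"
  proof -
    have "m * p \<le> m * 1" using p by (intro mult_left_mono) (auto simp: m_def)
    then show ?thesis using p by (simp add: \<epsilon>_def field_simps)
  qed
  then have q: "0 < q" using em by simp
  have VS: "v \<bullet> s = 0" if "v \<in> ?V" "s \<in> S" for v s
  proof -
    obtain k l where "v = k *\<^sub>R e1 + l *\<^sub>R e2" using \<open>v \<in> ?V\<close> by (rule span_pairE)
    then show ?thesis using perp[OF \<open>s \<in> S\<close>] by (simp add: inner_add_right inner_commute[of _ s])
  qed
  define A where "A v = enn2real (\<integral>\<^sup>+c. ennreal (?N (v + (\<Sum>b\<in>S. c b *\<^sub>R b)) powr - (m + 1)) \<partial>(\<Pi>\<^sub>M b\<in>S. lborel))" for v
  define \<psi> where "\<psi> v = (if v = 0 then 0 else A v powr - q)" for v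
  have g: "gauge_on ?V q \<psi>"
  proof -
    have "gauge_on ?V ((\<epsilon> * p - card S) / (\<epsilon> - card S)) (\<lambda>v. if v = 0 then 0 else
      enn2real (\<integral>\<^sup>+c. ennreal ((?N (v + (\<Sum>b\<in>S. c b *\<^sub>R b)) powr p) powr - \<epsilon>) \<partial>(\<Pi>\<^sub>M b\<in>S. lborel)) powr (- 1 / (\<epsilon> - card S)))"
      using S VS ep
      by (intro gauge_on_integrate[OF fin _ _ gauge_on_Minkowski[OF K p]])
         (auto simp: orthonormal_basis_def m_def)
    moreover have "(\<epsilon> * p - card S) / (\<epsilon> - card S) = q" "- 1 / (\<epsilon> - card S) = - q"
    proof -
      have "\<epsilon> * p - card S = 1" "\<epsilon> - card S = 1 / q" using ep em by (simp_all add: m_def)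
      then show "(\<epsilon> * p - card S) / (\<epsilon> - card S) = q" "- 1 / (\<epsilon> - card S) = - q" by simp_all
    qed
    moreover have "(r powr p) powr - \<epsilon> = r powr - (m + 1)" for r
      using ep by (simp add: powr_powr mult.commute)
    ultimately show ?thesis
      unfolding \<psi>_def[abs_def] A_def by (simp only:)
  qed
  have sv: "section_volume K (a *\<^sub>R e1 + b *\<^sub>R e2) = 2 / (m + 1) * A (a *\<^sub>R e2 - b *\<^sub>R e1)"
    and v0: "a *\<^sub>R e2 - b *\<^sub>R e1 \<in> ?V" "a *\<^sub>R e2 - b *\<^sub>R e1 \<noteq> 0"
    if ab: "a\<^sup>2 + b\<^sup>2 = 1" for a b
  proof -
    let ?v = "a *\<^sub>R e2 - b *\<^sub>R e1"
    note P = plane[OF ab]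
    show v0: "?v \<noteq> 0" using P(1) by (auto simp: orthonormal_basis_def)
    show V: "?v \<in> ?V" by (intro span_diff span_scale span_base) auto
    have pos: "0 < ?N (?v + (\<Sum>s\<in>S. c s *\<^sub>R s))" for c
    proof (rule Minkowski_pos[OF \<open>compact K\<close> \<open>absorbing K\<close>])
      have "?v \<bullet> (\<Sum>s\<in>S. c s *\<^sub>R s) = 0" using VS[OF V] by (simp add: inner_sum_right)
      then have "?v \<bullet> (?v + (\<Sum>s\<in>S. c s *\<^sub>R s)) = ?v \<bullet> ?v" by (simp only: inner_add_right add_0_right)
      then show "?v + (\<Sum>s\<in>S. c s *\<^sub>R s) \<noteq> 0" using v0 by (metis inner_eq_zero_iff inner_zero_right)
    qed
    have KN: "{x. ?N x \<le> 1} = K" using Minkowski_le_one_iff[OF c] by auto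
    have "emeasure (distr (\<Pi>\<^sub>M b\<in>insert ?v S. lborel) borel (\<lambda>f. \<Sum>b\<in>insert ?v S. f b *\<^sub>R b)) K
      = ennreal (2 / (m + 1)) * (\<integral>\<^sup>+c. ennreal (?N (?v + (\<Sum>b\<in>S. c b *\<^sub>R b)) powr - (m + 1)) \<partial>(\<Pi>\<^sub>M b\<in>S. lborel))"
      using emeasure_unit_ball_section[OF fin P(2) Minkowski_borel_measurable[OF K p] Minkowski_scaleR[OF c(1,2) K(1)] pos]
      unfolding KN m_def .
    then show "section_volume K (a *\<^sub>R e1 + b *\<^sub>R e2) = 2 / (m + 1) * A ?v"
      unfolding section_volume_orthonormal_basis[OF P(1,3) Kb] measure_def A_def
      by (simp add: enn2real_mult m_def del: sum.insert)
  qed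
  \<comment> \<open>If \<open>A\<close> were 0, which is also the default for an infinite integral,
    \<open>\<psi>\<close> would vanish at a nonzero vector of the plane. Positivity of the gauge
    thus gives positivity and finiteness of the integral together.\<close>
  have A0: "0 < A (a *\<^sub>R e2 - b *\<^sub>R e1)" if ab: "a\<^sup>2 + b\<^sup>2 = 1" for a b
  proof -
    have "0 < \<psi> (a *\<^sub>R e2 - b *\<^sub>R e1)" using g v0[OF ab] unfolding gauge_on_def by blast
    then have "A (a *\<^sub>R e2 - b *\<^sub>R e1) \<noteq> 0" using v0[OF ab] by (auto simp: \<psi>_def)
    then show ?thesis unfolding A_def by (simp add: less_le)
  qed
  have m0: "0 < m + 1" by (simp add: m_def add_nonneg_pos)
  show ?thesis
  proof (rule that[OF g])
    \<comment> \<open>The constant \<open>C\<close>: the section volume is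
      \<open>2 / (m + 1)\<close> times \<open>A\<close>, and its reciprocal is raised to the power
      \<open>q\<close>.\<close>
    show "0 < ((m + 1) / 2) powr q" using m0 by simp
    show "0 < section_volume K (a *\<^sub>R e1 + b *\<^sub>R e2)" if "a\<^sup>2 + b\<^sup>2 = 1" for a b
      using sv[OF that] A0[OF that] m0 by simp
    show "(1 / section_volume K (a *\<^sub>R e1 + b *\<^sub>R e2)) powr q = ((m + 1) / 2) powr q * \<psi> (a *\<^sub>R e2 - b *\<^sub>R e1)"
      if ab: "a\<^sup>2 + b\<^sup>2 = 1" for a b
    proof -
      have "(1 / section_volume K (a *\<^sub>R e1 + b *\<^sub>R e2)) powr q = ((m + 1) / 2 * inverse (A (a *\<^sub>R e2 - b *\<^sub>R e1))) powr q"
        unfolding sv[OF ab] by (simp add: inverse_eq_divide)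
      also have "\<dots> = ((m + 1) / 2) powr q * A (a *\<^sub>R e2 - b *\<^sub>R e1) powr - q"
        by (simp only: powr_mult powr_minus inverse_powr)
      finally show ?thesis using v0(2)[OF ab] by (simp add: \<psi>_def)
    qed
  qed
qed

text \<open>Each gauge axiom mentions at most two vectors, so it can be checked in a plane
  containing them, with a gauge that may vary with the plane.\<close>

theorem intersection_body_p_convex:
  fixes K :: "'a::euclidean_space set"
  assumes dim: "2 \<le> DIM('a)" and p: "0 < p" "p \<le> 1" and K: "origin_symmetric K" "p_convex p K"
  shows "p_convex (inverse ((1 / p - 1) * (real (DIM('a)) - 1) + 1)) (intersection_body K)"
proof -
  define q where "q = inverse ((1 / p - 1) * (real (DIM('a)) - 1) + 1)"
  let ?M = "\<lambda>x. Minkowski (intersection_body K) x"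
  note plane = intersection_body_plane[OF dim p K, folded q_def]
  have pos: "0 < section_volume K u" if u: "norm u = 1" for u
  proof -
    obtain e2 where e2: "e2 \<noteq> 0" "u \<bullet> e2 = 0"
      using orthogonal_to_vector_exists[OF dim, of u] by (metis orthogonal_def)
    obtain \<psi> :: "'a \<Rightarrow> real" and C where
      "\<And>a b. a\<^sup>2 + b\<^sup>2 = 1 \<Longrightarrow> 0 < section_volume K (a *\<^sub>R u + b *\<^sub>R (e2 /\<^sub>R norm e2))"
      by (rule plane[of u "e2 /\<^sub>R norm e2"]) (use u e2 in auto)
    from this[of 1 0] show ?thesis by simp
  qed
  have M_plane: "\<exists>\<psi>. gauge_on (span {e1, e2}) q \<psi> \<and> (\<forall>a b. ?M (a *\<^sub>R e1 + b *\<^sub>R e2) powr q = \<psi> (a *\<^sub>R e1 + b *\<^sub>R e2))"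
    if e: "norm e1 = 1" "norm e2 = 1" "e1 \<bullet> e2 = 0" for e1 e2 :: 'a
  proof -
    obtain \<psi> C where \<psi>: "gauge_on (span {e1, e2}) q \<psi>" "0 < C"
      "\<And>a b. a\<^sup>2 + b\<^sup>2 = 1 \<Longrightarrow>
        (1 / section_volume K (a *\<^sub>R e1 + b *\<^sub>R e2)) powr q = C * \<psi> (a *\<^sub>R e2 - b *\<^sub>R e1)"
      by (rule plane[OF e]) blast
    \<comment> \<open>On the plane this is the rotation sending \<open>e1\<close> to
      \<open>e2\<close> and \<open>e2\<close> to \<open>- e1\<close>. It is linear, and injective
      there, so composing \<open>\<psi>\<close> with it and scaling by \<open>C\<close> gives a
      gauge again.\<close>
    define J where "J z = (z \<bullet> e1) *\<^sub>R e2 - (z \<bullet> e2) *\<^sub>R e1" for z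
    have ee: "e1 \<bullet> e1 = 1" "e2 \<bullet> e2 = 1" "e2 \<bullet> e1 = 0" "e1 \<bullet> e2 = 0"
      using e by (simp_all add: norm_eq_1 inner_commute)
    have J: "J z \<in> span {e1, e2}" "J (x + y) = J x + J y" "J (c *\<^sub>R z) = c *\<^sub>R J z" for x y z c
    proof -
      have "e1 \<in> span {e1, e2}" "e2 \<in> span {e1, e2}" by (simp_all add: span_base)
      then show "J z \<in> span {e1, e2}" unfolding J_def by (intro span_diff span_scale)
      show "J (x + y) = J x + J y" "J (c *\<^sub>R z) = c *\<^sub>R J z"
        by (simp_all add: J_def inner_add_left algebra_simps)
    qed
    have J0: "z = 0" if "z \<in> span {e1, e2}" "J z = 0" for z
    proof -
      have "J z \<bullet> e2 = z \<bullet> e1" "J z \<bullet> e1 = - (z \<bullet> e2)" using ee by (simp_all add: J_def inner_diff_left)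
      then have "z \<bullet> e1 = 0" "z \<bullet> e2 = 0" using that(2) by simp_all
      then have "orthogonal z x" if "x \<in> {e1, e2}" for x using that by (auto simp: orthogonal_def)
      then have "orthogonal z z" by (rule orthogonal_to_span[OF that(1)])
      then show ?thesis by (simp add: orthogonal_def)
    qed
    have "gauge_on (span {e1, e2}) q (\<lambda>z. C * \<psi> (J z))"
      unfolding gauge_on_def
    proof (intro conjI ballI allI impI)
      fix x y c assume x: "x \<in> span {e1, e2}" and y: "y \<in> span {e1, e2}"
      show "C * \<psi> (J (x + y)) \<le> C * \<psi> (J x) + C * \<psi> (J y)"
        unfolding J(2) distrib_left[symmetric] using \<psi>(1,2) J(1)
        by (intro mult_left_mono) (auto simp: gauge_on_def)
    next
      fix x c assume x: "x \<in> span {e1, e2}"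
      show "C * \<psi> (J (c *\<^sub>R x)) = \<bar>c\<bar> powr q * (C * \<psi> (J x))"
        unfolding J(3) using \<psi>(1) J(1) by (simp add: gauge_on_def)
      show "0 < C * \<psi> (J x)" if "x \<noteq> 0"
        using \<psi>(1,2) J(1)[of x] J0[OF x] that by (auto simp: gauge_on_def)
    qed (use \<psi>(1) in \<open>auto simp: gauge_on_def\<close>)
    moreover have "?M z powr q = C * \<psi> (J z)" if z: "z = a *\<^sub>R e1 + b *\<^sub>R e2" for a b z
    proof (cases "z = 0")
      case True
      then show ?thesis
        using gauge_on_zero[OF \<psi>(1)] by (simp add: Minkowski_intersection_body_zero J_def)
    next
      case False
      let ?n = "norm z"
      have n: "?n\<^sup>2 = a\<^sup>2 + b\<^sup>2"
        unfolding power2_norm_eq_inner z using ee by (simp add: inner_add_left inner_add_right power2_eq_square)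
      have ab: "(a / ?n)\<^sup>2 + (b / ?n)\<^sup>2 = 1"
        using False by (simp add: power_divide flip: n add_divide_distrib)
      have u: "z /\<^sub>R ?n = (a / ?n) *\<^sub>R e1 + (b / ?n) *\<^sub>R e2"
        unfolding z by (simp add: scaleR_add_right divide_inverse mult.commute)
      have Ju: "J (z /\<^sub>R ?n) = (a / ?n) *\<^sub>R e2 - (b / ?n) *\<^sub>R e1"
        unfolding u J_def using ee by (simp add: inner_add_left)
      have "?M z powr q = (?n * (1 / section_volume K (z /\<^sub>R ?n))) powr q"
        using Minkowski_intersection_body[OF pos False] by simp
      also have "\<dots> = ?n powr q * (C * \<psi> (J (z /\<^sub>R ?n)))"
        using \<psi>(3)[OF ab] False pos[of "z /\<^sub>R ?n"] unfolding u[symmetric] Ju[symmetric]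
        by (subst powr_mult) simp_all
      also have "\<dots> = C * \<psi> (?n *\<^sub>R J (z /\<^sub>R ?n))"
        using \<psi>(1) J(1) unfolding gauge_on_def by simp
      also have "?n *\<^sub>R J (z /\<^sub>R ?n) = J z" using False by (simp flip: J(3))
      finally show ?thesis .
    qed
    ultimately show ?thesis by blast
  qed
  have pair: "\<exists>V \<psi>. gauge_on V q \<psi> \<and> x \<in> V \<and> y \<in> V \<and> (\<forall>z\<in>V. ?M z powr q = \<psi> z)" for x y
  proof -
    obtain e1 e2 where e: "norm e1 = 1" "norm e2 = 1" "e1 \<bullet> e2 = 0" "x \<in> span {e1, e2}" "y \<in> span {e1, e2}"
      using orthonormal_pair_spanning[OF dim] by blast
    obtain \<psi> where \<psi>: "gauge_on (span {e1, e2}) q \<psi>"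
      "\<And>a b. ?M (a *\<^sub>R e1 + b *\<^sub>R e2) powr q = \<psi> (a *\<^sub>R e1 + b *\<^sub>R e2)"
      using M_plane[OF e(1-3)] by blast
    have "?M z powr q = \<psi> z" if "z \<in> span {e1, e2}" for z
      using that by (rule span_pairE) (simp add: \<psi>(2))
    with \<psi>(1) e show ?thesis by blast
  qed
  have g: "gauge_on UNIV q (\<lambda>x. ?M x powr q)"
    unfolding gauge_on_def
  proof (intro conjI ballI allI impI)
    \<comment> \<open>The vectors are arbitrary here: the bounds on \<open>q\<close> are part of any
      gauge of degree \<open>q\<close>.\<close>
    obtain V :: "'a set" and \<psi> where "gauge_on V q \<psi>" using pair[of 0 0] by blast
    then show "0 < q" "q \<le> 1" by (auto simp: gauge_on_def)
    fix x y c
    obtain V \<psi> where V: "gauge_on V q \<psi>" "x \<in> V" "y \<in> V" "\<And>z. z \<in> V \<Longrightarrow> ?M z powr q = \<psi> z"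
      using pair[of x y] by blast
    then have s: "x + y \<in> V" "c *\<^sub>R x \<in> V"
      by (auto simp: gauge_on_def subspace_add subspace_scale)
    show "?M (x + y) powr q \<le> ?M x powr q + ?M y powr q" "?M (c *\<^sub>R x) powr q = \<bar>c\<bar> powr q * ?M x powr q"
      using V s by (auto simp: gauge_on_def)
    show "0 < ?M x powr q" if "x \<noteq> 0" using that V by (auto simp: gauge_on_def)
  qed simp
  have nonneg: "0 \<le> ?M x" for x
  proof (cases "x = 0")
    case False
    then show ?thesis
      by (simp add: Minkowski_intersection_body[OF pos] divide_nonneg_nonneg section_volume_nonneg)
  qed (simp add: Minkowski_intersection_body_zero)
  have "?M (c *\<^sub>R x) = c * ?M x" if "0 \<le> c" for c x
  proof (cases "c = 0 \<or> x = 0")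
    case False
    have "(c *\<^sub>R x) /\<^sub>R norm (c *\<^sub>R x) = (c * inverse c) *\<^sub>R (x /\<^sub>R norm x)"
      using that by (simp add: ac_simps)
    also have "\<dots> = x /\<^sub>R norm x" using False by simp
    finally have dir: "(c *\<^sub>R x) /\<^sub>R norm (c *\<^sub>R x) = x /\<^sub>R norm x" .
    have "?M x = norm x / section_volume K (x /\<^sub>R norm x)"
      using pos False by (intro Minkowski_intersection_body) auto
    moreover have "?M (c *\<^sub>R x) = norm (c *\<^sub>R x) / section_volume K ((c *\<^sub>R x) /\<^sub>R norm (c *\<^sub>R x))"
      using pos False by (intro Minkowski_intersection_body) auto
    ultimately show ?thesis
      unfolding dir using that by simp
  qed (auto simp: Minkowski_intersection_body_zero)
  then show ?thesis
    using p_convex_of_gauge[OF g intersection_body_eq_sublevel[OF pos] nonneg] by (simp add: q_def)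
qed

theorem theorem3:
  fixes K :: "(real ^ 'n) set" and p :: real
  assumes "CARD('n) \<ge> 2"
    and "0 < p" and "p \<le> 1"
    and "body K" and "origin_symmetric K" and "p_convex p K"
  shows "p_convex (inverse ((1 / p - 1) * (real CARD('n) - 1) + 1)) (intersection_body K)"
  using intersection_body_p_convex[of p K] assms by simp

end
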